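(* Let $\alpha>1$ and consider the algorithm PD with parameter $\delta=\frac{1}{\alpha^{\alpha-1}}$, on any number $m\ge 1$ of processors. The competitive ratio of PD is at most $\alpha^{\alpha}$, i.e. for every finite job set $J$, $$\mathrm{cost}(\mathrm{PD}(J))\le \alpha^{\alpha}\cdot \mathrm{cost}(\mathrm{OPT}(J)).$$ Moreover, there is a problem instance for which PD is exactly by a factor of $\alpha^\alpha$ worse than an optimal algorithm, i.e. an instance $J$ with $\mathrm{cost}(\mathrm{PD}(J))=\alpha^{\alpha}\cdot\mathrm{cost}(\mathrm{OPT}(J))$. That is, the upper bound $\alpha^\alpha$ on the competitive ratio of PD is optimal.
   Context: **Model.** Fix $\alpha>1$ and $P_\alpha(s)=s^\alpha$. There are $m\ge1$ speed-scalable processors. An instance is a finite job set $J=\{1,\dots,n\}$; job $j$ has release time $r_j\ge 0$, deadline $d_j>r_j$, workload $w_j>0$ and value $v_j>0$; jobs are numbered in order of release (ties arbitrary). A schedule $S$ consists of speed functions $S_i:\mathbb{R}_{\ge0}\to\mathbb{R}_{\ge0}$ ($i=1,\dots,m$) and a job assignment: at each time each processor runs at most one job and each job runs on at most one processor; preemption and migration are allowed. Job $j$ is finished if $\int_{r_j}^{d_j}s_j(t)\,dt\ge w_j$, where $s_j(t)$ is the speed at which $j$ is processed at time $t$. With $J_{\mathrm{rej}}$ the set of unfinished jobs, $\mathrm{cost}(S)=\sum_{i=1}^m\int_0^\infty P_\alpha(S_i(t))\,dt+\sum_{j\in J_{\mathrm{rej}}}v_j$. $\mathrm{OPT}(J)$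 is a schedule of minimum cost. In the online problem the existence and attributes of job $j$ are revealed at time $r_j$. **Atomic intervals.** Let $\tau_0<\dots<\tau_N$ be such that $\{\tau_0,\dots,\tau_N\}=\{r_j,d_j\mid j\in J\}$; $T_k$ is the interval from $\tau_{k-1}$ to $\tau_k$, $l_k=\tau_k-\tau_{k-1}$. Put $c_{jk}=1$ if $r_j\le\tau_{k-1}$ and $\tau_k\le d_j$, and $c_{jk}=0$ otherwise. A work assignment for $T_k$ is a vector $(x_{1k},\dots,x_{nk})\in\mathbb{R}_{\ge0}^n$, meaning that $x_{jk}w_j$ units of work of job $j$ are processed in $T_k$. **Chen et al.'s algorithm and $\mathcal{P}_k$.** Given a work assignment for $T_k$, order the jobs so that $x_{1k}w_1\ge\dots\ge x_{nk}w_n$. The set of dedicated jobs is $$\psi(k)=\Big\{j \,\Big|\, j\le m-1,\ x_{jk}>0,\ x_{jk}w_j\ge \tfrac{1}{m-j}\sum_{j'>j}x_{j'k}w_{j'}\Big\};$$ all other jobs are pool jobs. Each dedicated job runs alone on its own processor at speed $s_{jk}=x_{jk}w_j/l_k$; the pool jobs are scheduled greedily (with preemption) on the remaining $m-|\psi(k)|$ pool processors, all running at the common speed $s_{jk}=\frac{\sum_{j'\notin\psi(k)}x_{j'k}w_{j'}}{(m-|\psi(k)|)l_k}$. The energy used is $$\mathcal{P}_k(x_{1k},\dots,x_{nk})=\sum_{j\in\psi(k)}l_kP_\alpha\Big(\frac{x_{jk}w_j}{l_k}\Big)+(m-|\psi(k)|)\,l_k\,P_\alpha\Big(\frac{\sum_{j\notin\psi(k)}x_{jk}w_j}{(m-|\psi(k)|)l_k}\Big),$$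 which is the minimum energy needed to process this work in $T_k$. Partial derivatives at points of the boundary of $\mathbb{R}^n_{\ge0}$ are one-sided. **Algorithm PD with parameter $\delta>0$.** Jobs are handled in the order $1,\dots,n$ of arrival. When $j$ is handled, the values $\tilde x_{1k},\dots,\tilde x_{j-1,k}$ are already fixed. For $c_{jk}=1$ and $z\ge0$ put $\lambda_{jk}(z)=\delta\,\frac{\partial\mathcal{P}_k}{\partial x_{jk}}(\tilde x_{1k},\dots,\tilde x_{j-1,k},z,0,\dots,0)$ (continuous, strictly increasing and unbounded in $z$). PD continuously raises the portions $x_{jk}$ of the intervals with currently minimal $\lambda_{jk}$, keeping these minimal values equal, until either $\sum_kx_{jk}=1$ (the job is accepted) or the minimal value reaches $v_j$ (the job is rejected). Formally, for $\mu\ge0$ let $z_{jk}(\mu)=0$ if $c_{jk}=0$ or $\lambda_{jk}(0)\ge\mu$, and otherwise let $z_{jk}(\mu)$ be the unique $z$ with $\lambda_{jk}(z)=\mu$. If $\sum_kz_{jk}(v_j)\ge1$, set $\tilde y_j=1$, let $\tilde\lambda_j$ be the unique $\mu\le v_j$ with $\sum_kz_{jk}(\mu)=1$, and set $\tilde x_{jk}=z_{jk}(\tilde\lambda_j)$. Otherwise set $\tilde y_j=0$, $\tilde x_{jk}=0$ for all $k$, and $\tilde\lambda_j=v_j$. The schedule $\mathrm{PD}(J)$ is obtained by applying Chen et al.'s algorithm to $(\tilde x_{1k},\dots,\tilde x_{nk})$ in each $T_k$; thus $\mathrm{cost}(\mathrm{PD}(J))=\sum_k\mathcal{P}_k(\tilde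 x_{1k},\dots,\tilde x_{nk})+\sum_j(1-\tilde y_j)v_j$. (Run online, PD uses the partition induced by the jobs known so far and, when an interval is split, splits already assigned portions proportionally to lengths; this gives the same schedule.) The competitive ratio is $\sup_J \mathrm{cost}(\mathrm{PD}(J))/\mathrm{cost}(\mathrm{OPT}(J))$.
   Formalization: An instance with cost exactly α^α times optimal exists only as the empty job set (0 = α^α·0); for nonempty J the inequality is strict. Optimality of the bound is instead proved as: the competitive ratio (supremum over all J) equals α^α. *)

theory Defs
  imports "HOL-Analysis.Analysis"
begin

section \<open>Instances\<close>

record job =
  release :: real
  deadline :: real
  workload :: real
  worth :: real

text \<open>
  Job number \<open>j + 1\<close> of the model is \<open>J ! j\<close>: jobs, processors and atomic intervals are all
  numbered from \<open>0\<close>. The list order is the order in which the jobs are handled, so every way of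
  breaking ties between equal release times is a separate list. The empty job set (\<open>J = []\<close>) is an
  instance.
\<close>

definition job_instance :: "job list \<Rightarrow> bool" where
  "job_instance J \<longleftrightarrow>
     (\<forall>q\<in>set J. 0 \<le> release q \<and> release q < deadline q \<and> 0 < workload q \<and> 0 < worth q) \<and>
     sorted (map release J)"

section \<open>Schedules and optimal cost\<close>

text \<open>
  \<open>speed i t\<close> is the speed of processor \<open>i\<close> at time \<open>t\<close>, and \<open>run i t\<close> is the job that it processes
  (\<open>None\<close> if there is none). Only times \<open>t \<ge> 0\<close> and processors \<open>i < m\<close> matter.
\<close>

record schedule =
  speed :: "nat \<Rightarrow> real \<Rightarrow> real"
  run :: "nat \<Rightarrow> real \<Rightarrow> nat option"

definition valid_schedule :: "nat \<Rightarrow> job list \<Rightarrow> schedule \<Rightarrow> bool" where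
  "valid_schedule m J S \<longleftrightarrow>
     (\<forall>i<m. speed S i \<in> borel_measurable borel) \<and>
     (\<forall>i<m. \<forall>j. {t. run S i t = Some j} \<in> sets borel) \<and>
     (\<forall>i<m. \<forall>t\<ge>0. 0 \<le> speed S i t) \<and>
     (\<forall>i<m. \<forall>t\<ge>0. \<forall>j. run S i t = Some j \<longrightarrow> j < length J) \<and>
     (\<forall>i<m. \<forall>i'<m. \<forall>t\<ge>0. \<forall>j. run S i t = Some j \<and> run S i' t = Some j \<longrightarrow> i = i')"

text \<open>The sum has at most one term when the schedule is valid.\<close>

definition job_speed :: "nat \<Rightarrow> schedule \<Rightarrow> nat \<Rightarrow> real \<Rightarrow> real" where
  "job_speed m S j t = (\<Sum>i | i < m \<and> run S i t = Some j. speed S i t)"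

definition finished :: "nat \<Rightarrow> job list \<Rightarrow> schedule \<Rightarrow> nat \<Rightarrow> bool" where
  "finished m J S j \<longleftrightarrow>
     ennreal (workload (J ! j)) \<le>
       (\<integral>\<^sup>+t\<in>{release (J ! j)..deadline (J ! j)}. ennreal (job_speed m S j t) \<partial>lborel)"

definition rejected :: "nat \<Rightarrow> job list \<Rightarrow> schedule \<Rightarrow> nat set" where
  "rejected m J S = {j. j < length J \<and> \<not> finished m J S j}"

text \<open>The cost may be infinite, since nothing bounds the energy of an arbitrary schedule.\<close>

definition schedule_cost :: "real \<Rightarrow> nat \<Rightarrow> job list \<Rightarrow> schedule \<Rightarrow> ennreal" where
  "schedule_cost \<alpha> m J S =
     (\<Sum>i<m. \<integral>\<^sup>+t\<in>{0..}. ennreal (speed S i t powr \<alpha>) \<partial>lborel) +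
     ennreal (\<Sum>j\<in>rejected m J S. worth (J ! j))"

definition optimal_schedule :: "real \<Rightarrow> nat \<Rightarrow> job list \<Rightarrow> schedule \<Rightarrow> bool" where
  "optimal_schedule \<alpha> m J S \<longleftrightarrow>
     valid_schedule m J S \<and>
     (\<forall>S'. valid_schedule m J S' \<longrightarrow> schedule_cost \<alpha> m J S \<le> schedule_cost \<alpha> m J S')"

definition opt_cost :: "real \<Rightarrow> nat \<Rightarrow> job list \<Rightarrow> ennreal" where
  "opt_cost \<alpha> m J = (INF S\<in>{S. valid_schedule m J S}. schedule_cost \<alpha> m J S)"

lemma opt_cost_eq_optimal_schedule:
  assumes "optimal_schedule \<alpha> m J S"
  shows "opt_cost \<alpha> m J = schedule_cost \<alpha> m J S"
  using assms unfolding opt_cost_def optimal_schedule_def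
  by (intro antisym INF_lower INF_greatest) auto

section \<open>Atomic intervals\<close>

definition time_points :: "job list \<Rightarrow> real list" where
  "time_points J = sorted_list_of_set (release ` set J \<union> deadline ` set J)"

definition num_intervals :: "job list \<Rightarrow> nat" where
  "num_intervals J = length (time_points J) - 1"

text \<open>Interval \<open>k\<close> with \<open>k < num_intervals J\<close> reaches from \<open>\<tau>\<^sub>k\<close> to \<open>\<tau>\<^sub>k\<^sub>+\<^sub>1\<close>.\<close>

definition interval_length :: "job list \<Rightarrow> nat \<Rightarrow> real" where
  "interval_length J k = time_points J ! (k + 1) - time_points J ! k"

definition available :: "job list \<Rightarrow> nat \<Rightarrow> nat \<Rightarrow> bool" where
  "available J j k \<longleftrightarrow>
     release (J ! j) \<le> time_points J ! k \<and> time_points J ! (k + 1) \<le> deadline (J ! j)"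

section \<open>Chen et al.'s algorithm in one atomic interval\<close>

text \<open>
  A work assignment \<open>x\<close> of one interval maps each job to the portion of its workload that is
  processed there.
\<close>

definition load :: "job list \<Rightarrow> (nat \<Rightarrow> real) \<Rightarrow> nat \<Rightarrow> real" where
  "load J x j = x j * workload (J ! j)"

text \<open>
  The jobs by non-increasing load. Sorting is stable, so equal loads are ordered by job number; the
  energy does not depend on this choice.
\<close>

definition load_order :: "job list \<Rightarrow> (nat \<Rightarrow> real) \<Rightarrow> nat list" where
  "load_order J x = sort_key (\<lambda>j. - load J x j) [0..<length J]"

text \<open>Position \<open>p\<close> of the ordered list is rank \<open>p + 1\<close> in the usual numbering from \<open>1\<close>.\<close>

definition dedicated :: "nat \<Rightarrow> job list \<Rightarrow> (nat \<Rightarrow> real) \<Rightarrow> nat set" where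
  "dedicated m J x =
     {load_order J x ! p | p. p < length J \<and> p + 1 < m \<and> 0 < x (load_order J x ! p) \<and>
        (\<Sum>q\<in>{p<..<length J}. load J x (load_order J x ! q)) / (real m - real (p + 1))
          \<le> load J x (load_order J x ! p)}"

definition interval_energy :: "real \<Rightarrow> nat \<Rightarrow> job list \<Rightarrow> nat \<Rightarrow> (nat \<Rightarrow> real) \<Rightarrow> real" where
  "interval_energy \<alpha> m J k x =
     (let l = interval_length J k;
          D = dedicated m J x;
          p = real m - real (card D)
      in (\<Sum>j\<in>D. l * (load J x j / l) powr \<alpha>) +
         p * l * ((\<Sum>j\<in>{..<length J} - D. load J x j) / (p * l)) powr \<alpha>)"

section \<open>Algorithm PD\<close>

text \<open>
  In the following, \<open>X i k\<close> is the portion of job \<open>i\<close> assigned to interval \<open>k\<close>; while job \<open>j\<close> is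
  being handled, \<open>X i k = 0\<close> for all \<open>i \<ge> j\<close>. The derivative within \<open>{0..}\<close> is the ordinary one for
  \<open>z > 0\<close> and the right-sided one for \<open>z = 0\<close>.
\<close>

definition pd_marginal ::
  "real \<Rightarrow> nat \<Rightarrow> real \<Rightarrow> job list \<Rightarrow> (nat \<Rightarrow> nat \<Rightarrow> real) \<Rightarrow> nat \<Rightarrow> nat \<Rightarrow> real \<Rightarrow> real" where
  "pd_marginal \<alpha> m \<delta> J X j k z =
     \<delta> * vector_derivative (\<lambda>y. interval_energy \<alpha> m J k ((\<lambda>i. X i k)(j := y))) (at z within {0..})"

definition pd_level ::
  "real \<Rightarrow> nat \<Rightarrow> real \<Rightarrow> job list \<Rightarrow> (nat \<Rightarrow> nat \<Rightarrow> real) \<Rightarrow> nat \<Rightarrow> nat \<Rightarrow> real \<Rightarrow> real" where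
  "pd_level \<alpha> m \<delta> J X j k \<mu> =
     (if \<not> available J j k \<or> \<mu> \<le> pd_marginal \<alpha> m \<delta> J X j k 0 then 0
      else (THE z. 0 \<le> z \<and> pd_marginal \<alpha> m \<delta> J X j k z = \<mu>))"

definition pd_total ::
  "real \<Rightarrow> nat \<Rightarrow> real \<Rightarrow> job list \<Rightarrow> (nat \<Rightarrow> nat \<Rightarrow> real) \<Rightarrow> nat \<Rightarrow> real \<Rightarrow> real" where
  "pd_total \<alpha> m \<delta> J X j \<mu> = (\<Sum>k<num_intervals J. pd_level \<alpha> m \<delta> J X j k \<mu>)"

definition pd_accepts ::
  "real \<Rightarrow> nat \<Rightarrow> real \<Rightarrow> job list \<Rightarrow> (nat \<Rightarrow> nat \<Rightarrow> real) \<Rightarrow> nat \<Rightarrow> bool" where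
  "pd_accepts \<alpha> m \<delta> J X j \<longleftrightarrow> 1 \<le> pd_total \<alpha> m \<delta> J X j (worth (J ! j))"

definition pd_price ::
  "real \<Rightarrow> nat \<Rightarrow> real \<Rightarrow> job list \<Rightarrow> (nat \<Rightarrow> nat \<Rightarrow> real) \<Rightarrow> nat \<Rightarrow> real" where
  "pd_price \<alpha> m \<delta> J X j =
     (if pd_accepts \<alpha> m \<delta> J X j
      then (THE \<mu>. 0 \<le> \<mu> \<and> \<mu> \<le> worth (J ! j) \<and> pd_total \<alpha> m \<delta> J X j \<mu> = 1)
      else worth (J ! j))"

definition pd_portions ::
  "real \<Rightarrow> nat \<Rightarrow> real \<Rightarrow> job list \<Rightarrow> (nat \<Rightarrow> nat \<Rightarrow> real) \<Rightarrow> nat \<Rightarrow> nat \<Rightarrow> real" where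
  "pd_portions \<alpha> m \<delta> J X j k =
     (if pd_accepts \<alpha> m \<delta> J X j then pd_level \<alpha> m \<delta> J X j k (pd_price \<alpha> m \<delta> J X j) else 0)"

text \<open>\<open>pd_assignment \<alpha> m \<delta> J j\<close> is the state after the first \<open>j\<close> jobs have been handled.\<close>

primrec pd_assignment ::
  "real \<Rightarrow> nat \<Rightarrow> real \<Rightarrow> job list \<Rightarrow> nat \<Rightarrow> nat \<Rightarrow> nat \<Rightarrow> real" where
  "pd_assignment \<alpha> m \<delta> J 0 = (\<lambda>i k. 0)"
| "pd_assignment \<alpha> m \<delta> J (Suc j) =
     (pd_assignment \<alpha> m \<delta> J j)(j := pd_portions \<alpha> m \<delta> J (pd_assignment \<alpha> m \<delta> J j) j)"

definition pd_cost :: "real \<Rightarrow> nat \<Rightarrow> real \<Rightarrow> job list \<Rightarrow> real" where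
  "pd_cost \<alpha> m \<delta> J =
     (\<Sum>k<num_intervals J. interval_energy \<alpha> m J k (\<lambda>j. pd_assignment \<alpha> m \<delta> J (length J) j k)) +
     (\<Sum>j | j < length J \<and> \<not> pd_accepts \<alpha> m \<delta> J (pd_assignment \<alpha> m \<delta> J j) j. worth (J ! j))"

text \<open>
  The empty instance has cost \<open>0\<close> under every algorithm and contributes \<open>0 / 0 = 0\<close> to the supremum.
\<close>

definition competitive_ratio :: "real \<Rightarrow> nat \<Rightarrow> real \<Rightarrow> ennreal" where
  "competitive_ratio \<alpha> m \<delta> =
     (SUP J\<in>{J. job_instance J}. ennreal (pd_cost \<alpha> m \<delta> J) / opt_cost \<alpha> m J)"

end

theory Submission
  imports Defs
begin

text \<open>
  In an atomic interval of unit length with loads \<open>a\<^sub>j\<close>, Chen et al.'s pool speed is the largest \<open>h \<ge> 0\<close>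
  with \<open>\<Sum>\<^sub>j min a\<^sub>j h = m h\<close> and job \<open>j\<close> runs at speed \<open>max a\<^sub>j h\<close>. Young's inequality turns these
  speeds into subgradients of the energy, which gives its convexity and its partial derivatives.

  For the upper bound, the prices \<open>\<lambda>\<^sub>j\<close> of PD are used as dual variables. Let \<open>\<alpha> \<sigma>\<^sub>j\<close> be the speed at
  which PD last planned job \<open>j\<close>, so that \<open>\<lambda>\<^sub>j = \<alpha> w\<^sub>j \<sigma>\<^sub>j\<^bsup>\<alpha>-1\<^esup>\<close> for \<open>\<delta> = \<alpha>\<^bsup>1-\<alpha>\<^esup>\<close>. Weak duality bounds the
  cost of every schedule from below by \<open>\<Sum>\<^sub>j \<lambda>\<^sub>j\<close> minus \<open>(\<alpha> - 1) \<sigma>\<^sub>j\<^bsup>\<alpha>\<^esup>\<close> integrated over the at most \<open>m\<close>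
  running jobs. Accepted jobs were planned no faster than they finally run. A rejected job exceeds its
  final speed by at most the load planned for it, because one load changes the pool speed by no more
  than its own change; the excess is charged to the value of the rejected job.

  The ratio is approached by stages \<open>i = 0, \<dots>, N\<close> of \<open>m\<close> equal jobs released at \<open>1 - q\<^bsup>i\<^esup>\<close> with common
  deadline \<open>1\<close>, density \<open>w\<^sub>i / q\<^bsup>i\<^esup> = (1 - q) q\<^bsup>-i/\<alpha>\<^esup>\<close> and prohibitive values. PD spreads each job evenly
  until the deadline, whereas each stage can be finished before the next one arrives; with \<open>p = q\<^bsup>1/\<alpha>\<^esup>\<close>
  the cost ratio tends to \<open>((1 - p\<^bsup>\<alpha>\<^esup>) / (1 - p))\<^bsup>\<alpha>\<^esup>\<close> as \<open>N \<rightarrow> \<infinity>\<close>, and to \<open>\<alpha>\<^bsup>\<alpha>\<^esup>\<close> as \<open>p \<rightarrow> 1\<close>.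
\<close>

section \<open>Pool speed and energy of a load vector\<close>

text \<open>Asking for an inequality makes the set closed and puts 0 into it for nonnegative loads,
  so the supremum is attained and the balance equation can be derived from it.\<close>

definition pool_level :: "nat \<Rightarrow> 'a set \<Rightarrow> ('a \<Rightarrow> real) \<Rightarrow> real" where
  "pool_level m A a = Sup {h. 0 \<le> h \<and> real m * h \<le> (\<Sum>j\<in>A. min (a j) h)}"

definition chen_speed :: "nat \<Rightarrow> 'a set \<Rightarrow> ('a \<Rightarrow> real) \<Rightarrow> 'a \<Rightarrow> real" where
  "chen_speed m A a j = max (a j) (pool_level m A a)"

text \<open>Every processor is charged the pool speed and each job above it adds its surplus. Pool
  jobs contribute 0, so neither a dedicated set nor an ordering of the loads appears.\<close>

definition chen_energy :: "real \<Rightarrow> nat \<Rightarrow> 'a set \<Rightarrow> ('a \<Rightarrow> real) \<Rightarrow> real" where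
  "chen_energy \<alpha> m A a =
     real m * pool_level m A a powr \<alpha> +
     (\<Sum>j\<in>A. chen_speed m A a j powr \<alpha> - pool_level m A a powr \<alpha>)"

section \<open>Existence, uniqueness and monotonicity of the pool speed\<close>

lemma pool_level_cong:
  "(\<And>j. j \<in> A \<Longrightarrow> a j = b j) \<Longrightarrow> pool_level m A a = pool_level m A b"
  unfolding pool_level_def by (simp cong: sum.cong)

text \<open>The feasible levels form a closed set bounded by the total load, so a largest one
  exists. Slack there would, by the intermediate value theorem, leave a solution strictly above
  it.\<close>

lemma pool_level_props:
  assumes "finite A" "m \<ge> 1" "\<forall>j\<in>A. 0 \<le> a j"
  shows pool_level_nonneg: "0 \<le> pool_level m A a"
    and pool_level_upper:
      "\<And>h. 0 \<le> h \<Longrightarrow> real m * h \<le> (\<Sum>j\<in>A. min (a j) h) \<Longrightarrow> h \<le> pool_level m A a"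
    and pool_level_eq: "(\<Sum>j\<in>A. min (a j) (pool_level m A a)) = real m * pool_level m A a"
proof -
  define H where "H = {h. 0 \<le> h \<and> real m * h \<le> (\<Sum>j\<in>A. min (a j) h)}"
  have H0: "0 \<in> H" using assms by (auto simp: H_def intro!: sum_nonneg)
  have ub: "h \<le> sum a A" if "h \<in> H" for h
  proof -
    have "h \<le> real m * h" using that assms(2) by (simp add: H_def mult_le_cancel_right1)
    also have "\<dots> \<le> (\<Sum>j\<in>A. min (a j) h)" using that by (simp add: H_def)
    also have "\<dots> \<le> sum a A" by (intro sum_mono) auto
    finally show ?thesis .
  qed
  have bdd: "bdd_above H" using ub by (auto simp: bdd_above_def)
  have "closed {h. 0 \<le> h \<and> real m * h \<le> (\<Sum>j\<in>A. min (a j) h)}"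
    by (intro closed_Collect_conj closed_Collect_le continuous_intros)
  then have cl: "closed H" by (simp add: H_def)
  have SH: "Sup H \<in> H" using closed_contains_Sup[OF _ bdd cl] H0 by auto
  have pl: "pool_level m A a = Sup H" by (simp add: pool_level_def H_def)
  show "0 \<le> pool_level m A a" using SH pl by (auto simp: H_def)
  show *: "h \<le> pool_level m A a" if "0 \<le> h" "real m * h \<le> (\<Sum>j\<in>A. min (a j) h)" for h
    using cSup_upper[OF _ bdd, of h] that pl by (auto simp: H_def)
  let ?h = "pool_level m A a"
  let ?g = "\<lambda>h. (\<Sum>j\<in>A. min (a j) h) - real m * h"
  show "(\<Sum>j\<in>A. min (a j) ?h) = real m * ?h"
  proof (rule ccontr)
    assume "(\<Sum>j\<in>A. min (a j) ?h) \<noteq> real m * ?h"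
    then have pos: "?g ?h > 0" using SH pl by (auto simp: H_def)
    have h0: "0 \<le> ?h" using SH pl by (auto simp: H_def)
    \<comment> \<open>Beyond the total load the sum of minima is at most \<open>h'\<close>, hence at
      most \<open>m h'\<close>; this is the far end for the intermediate value theorem.\<close>
    define h' where "h' = max (?h) (sum a A) + 1"
    have hh': "?h \<le> h'" "0 \<le> h'" using h0 by (auto simp: h'_def)
    have neg: "?g h' \<le> 0"
    proof -
      have "(\<Sum>j\<in>A. min (a j) h') \<le> sum a A" by (intro sum_mono) auto
      also have "\<dots> \<le> h'" by (simp add: h'_def)
      also have "\<dots> \<le> real m * h'" using hh' assms(2) by (simp add: mult_le_cancel_right1)
      finally show ?thesis by simp
    qed
    have "continuous_on {?h..h'} ?g" by (intro continuous_intros)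
    then have "\<exists>x\<ge>?h. x \<le> h' \<and> ?g x = 0"
      by (rule IVT2'[OF neg less_imp_le[OF pos] hh'(1)])
    then obtain x where x: "?h \<le> x" "?g x = 0" by auto
    then have "x \<le> ?h" using * h0 by simp
    then show False using x pos by simp
  qed
qed

lemma pool_level_unique:
  assumes "finite A" "m \<ge> 1" "\<forall>j\<in>A. 0 \<le> a j"
    and "0 \<le> h" "real m * h \<le> (\<Sum>j\<in>A. min (a j) h)"
    and "\<And>h'. h' > h \<Longrightarrow> (\<Sum>j\<in>A. min (a j) h') < real m * h'"
  shows "pool_level m A a = h"
proof (rule antisym)
  show "pool_level m A a \<le> h"
    using pool_level_eq[OF assms(1-3)] assms(6)[of "pool_level m A a"] by fastforce
qed (rule pool_level_upper[OF assms(1-5)])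

lemma pool_level_mono:
  assumes "finite A" "m \<ge> 1" "\<forall>j\<in>A. 0 \<le> a j" "\<forall>j\<in>A. a j \<le> b j"
  shows "pool_level m A a \<le> pool_level m A b"
proof (rule pool_level_upper)
  show "\<forall>j\<in>A. 0 \<le> b j" using assms(3,4) by force
  show "real m * pool_level m A a \<le> (\<Sum>j\<in>A. min (b j) (pool_level m A a))"
    unfolding pool_level_eq[OF assms(1-3), symmetric] using assms(4)
    by (intro sum_mono min.mono) auto
qed (use assms pool_level_nonneg[OF assms(1-3)] in auto)

lemma chen_speed_mono:
  assumes "finite A" "m \<ge> 1" "\<forall>j\<in>A. 0 \<le> a j" "\<forall>j\<in>A. a j \<le> b j" "i \<in> A"
  shows "chen_speed m A a i \<le> chen_speed m A b i"
  unfolding chen_speed_def using pool_level_mono[OF assms(1-4)] assms(4,5) by (intro max.mono) auto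

lemma chen_speed_nonneg:
  assumes "finite A" "m \<ge> 1" "\<forall>j\<in>A. 0 \<le> a j"
  shows "0 \<le> chen_speed m A a i"
  unfolding chen_speed_def using pool_level_nonneg[OF assms] by (simp add: le_max_iff_disj)

text \<open>If raising one load by \<open>u\<close> raised the level by more than \<open>u\<close>, at least \<open>m\<close> other jobs would
  exceed the new level minus \<open>u\<close>, so that level would already have been reached before.\<close>

lemma pool_level_update_lipschitz:
  assumes fin: "finite A" and m: "m \<ge> 1" and a: "\<forall>i\<in>A. 0 \<le> a i"
    and j: "j \<in> A" and z: "0 \<le> z" and u: "0 \<le> u"
  shows "pool_level m A (a(j := z + u)) \<le> pool_level m A (a(j := z)) + u"
proof (rule ccontr)
  define b where "b = a(j := z)"
  define b' where "b' = a(j := z + u)"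
  have b0: "\<forall>i\<in>A. 0 \<le> b i" and b'0: "\<forall>i\<in>A. 0 \<le> b' i"
    using a z u by (auto simp: b_def b'_def)
  define h where "h = pool_level m A b' - u"
  assume "\<not> ?thesis"
  then have hgt: "h > pool_level m A b" by (simp add: h_def b_def b'_def)
  have h0: "0 \<le> h" using hgt pool_level_nonneg[OF fin m b0] by simp
  have lt: "(\<Sum>i\<in>A. min (b i) h) < real m * h"
    using pool_level_upper[OF fin m b0 h0] hgt by (meson leI not_less)
  have eq: "(\<Sum>i\<in>A. min (b' i) (h + u)) = real m * (h + u)"
    using pool_level_eq[OF fin m b'0] by (simp add: h_def)
  define B where "B = {i \<in> A - {j}. h < b i}"
  have split: "sum f A = f j + sum f (A - {j})" for f :: "'a \<Rightarrow> real"
    using sum.remove[OF fin j] by blast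
  have "(\<Sum>i\<in>A-{j}. min (b' i) (h + u) - min (b i) h) \<le> (\<Sum>i\<in>A-{j}. if h < b i then u else 0)"
    by (intro sum_mono) (use u in \<open>auto simp: b_def b'_def min_def\<close>)
  also have "\<dots> = (\<Sum>i\<in>B. u)" unfolding B_def by (rule sum.inter_filter[symmetric]) (simp add: fin)
  also have "\<dots> = card B * u" by simp
  finally have up: "(\<Sum>i\<in>A-{j}. min (b' i) (h + u)) - (\<Sum>i\<in>A-{j}. min (b i) h) \<le> card B * u"
    by (simp add: sum_subtractf)
  have jj: "min (b' j) (h + u) = min (b j) h + u" by (simp add: b_def b'_def min_def)
  have "real m * u < u + card B * u"
    using up lt eq jj split[of "\<lambda>i. min (b' i) (h + u)"] split[of "\<lambda>i. min (b i) h"]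
    by (simp add: algebra_simps)
  then have "u * real m < u * real (card B + 1)" by (simp add: algebra_simps)
  then have "m \<le> card B" using u by (simp add: mult_less_cancel_left)
  then have "real m * h \<le> real (card B) * h" using h0 by (simp add: mult_right_mono)
  also have "\<dots> = (\<Sum>i\<in>B. min (b i) h)" by (simp add: B_def)
  also have "\<dots> \<le> (\<Sum>i\<in>A. min (b i) h)"
    by (intro sum_mono2) (use fin h0 b0 in \<open>auto simp: B_def\<close>)
  finally show False using lt by simp
qed

lemma chen_speed_update_continuous:
  assumes "finite A" "m \<ge> 1" "\<forall>i\<in>A. 0 \<le> a i" "j \<in> A"
  shows "continuous_on {0..} (\<lambda>z. chen_speed m A (a(j := z)) j)"
proof -
  have le: "\<bar>pool_level m A (a(j := z)) - pool_level m A (a(j := y))\<bar> \<le> \<bar>z - y\<bar>"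
    if "0 \<le> y" "y \<le> z" for y z
    using pool_level_update_lipschitz[OF assms, of y "z - y"]
      pool_level_mono[of A m "a(j := y)" "a(j := z)"] assms that by auto
  have le': "\<bar>pool_level m A (a(j := z)) - pool_level m A (a(j := y))\<bar> \<le> 1 * \<bar>z - y\<bar>"
    if "z \<in> {0..}" "y \<in> {0..}" for y z
    using le[of y z] le[of z y] that by (cases "y \<le> z") (auto simp: abs_minus_commute)
  have "1-lipschitz_on {0..} (\<lambda>z. pool_level m A (a(j := z)))"
    using le' by (auto simp: lipschitz_on_def dist_real_def)
  then have "continuous_on {0..} (\<lambda>z. pool_level m A (a(j := z)))"
    by (rule lipschitz_on_continuous_on)
  then have "continuous_on {0..} (\<lambda>z. max z (pool_level m A (a(j := z))))"
    by (intro continuous_on_max continuous_on_id)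
  then show ?thesis by (simp add: chen_speed_def)
qed

text \<open>A job at or above the pool speed runs at its own load, where growth is immediate. For a
  pool job, equal levels \<open>h\<close> before and after would give equal balance sums and thus
  \<open>min y h = min z h\<close> with \<open>y < h\<close>, which \<open>y < z\<close>
  excludes.\<close>

lemma chen_speed_update_strict_mono:
  assumes "finite A" "m \<ge> 1" "\<forall>i\<in>A. 0 \<le> a i" "j \<in> A" "0 \<le> y" "y < z"
  shows "chen_speed m A (a(j := y)) j < chen_speed m A (a(j := z)) j"
proof -
  let ?h = "\<lambda>z. pool_level m A (a(j := z))"
  have le: "?h y \<le> ?h z" by (rule pool_level_mono) (use assms in auto)
  show ?thesis
  proof (cases "y < ?h y")
    case True
    have split: "sum f A = f j + sum f (A - {j})" for f :: "'a \<Rightarrow> real"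
      using sum.remove[OF assms(1) assms(4)] by blast
    have "?h y \<noteq> ?h z"
    proof
      assume eq: "?h y = ?h z"
      have "(\<Sum>i\<in>A. min ((a(j := y)) i) (?h y)) = (\<Sum>i\<in>A. min ((a(j := z)) i) (?h y))"
        using pool_level_eq[of A m "a(j := y)"] pool_level_eq[of A m "a(j := z)"] assms
        by (subst (2) eq) (simp add: eq)
      then have "min y (?h y) = min z (?h y)"
        unfolding split by (auto simp: sum.cong[of "A - {j}" "A - {j}" "\<lambda>i. min ((a(j := y)) i) (?h y)" "\<lambda>i. min ((a(j := z)) i) (?h y)"])
      then show False using True assms by (auto simp: min_def split: if_splits)
    qed
    then show ?thesis using True le unfolding chen_speed_def by (simp add: max_def)
  next
    case False
    then show ?thesis using assms unfolding chen_speed_def by (simp add: max_def)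
  qed
qed

text \<open>The fraction \<open>a j / chen_speed m A a j\<close> is the share of the interval during which \<open>j\<close> runs; it is
  \<open>0 / 0 = 0\<close> for jobs without load when the pool is empty.\<close>

lemma chen_weights:
  assumes fin: "finite A" and m: "m \<ge> 1" and a: "\<forall>j\<in>A. 0 \<le> a j" and "\<alpha> > 1"
  defines "s \<equiv> chen_speed m A a"
  defines "\<theta> \<equiv> \<lambda>j. a j / s j"
  shows "\<And>j. j \<in> A \<Longrightarrow> 0 \<le> \<theta> j \<and> \<theta> j \<le> 1 \<and> \<theta> j * s j = a j"
    and "sum \<theta> A \<le> real m"
    and "(\<Sum>j\<in>A. \<theta> j * s j powr \<alpha>) = chen_energy \<alpha> m A a"
proof -
  let ?h = "pool_level m A a"
  have h0: "0 \<le> ?h" by (rule pool_level_nonneg[OF fin m a])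
  have sa: "a j \<le> s j" "?h \<le> s j" for j by (auto simp: s_def chen_speed_def)
  show 1: "0 \<le> \<theta> j \<and> \<theta> j \<le> 1 \<and> \<theta> j * s j = a j" if "j \<in> A" for j
    using a that sa[of j] by (auto simp: \<theta>_def divide_le_eq_1)
  have energy: "chen_energy \<alpha> m A a = real m * ?h powr \<alpha> + (\<Sum>j\<in>A. s j powr \<alpha> - ?h powr \<alpha>)"
    by (simp add: chen_energy_def s_def)
  have "sum \<theta> A \<le> real m \<and> (\<Sum>j\<in>A. \<theta> j * s j powr \<alpha>) = chen_energy \<alpha> m A a"
  proof (cases "?h = 0")
    case True
    have s: "s j = a j" if "j \<in> A" for j using a that True by (simp add: s_def chen_speed_def)
    have \<theta>: "\<theta> j = (if a j > 0 then 1 else 0)" if "j \<in> A" for j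
      using a that s[OF that] by (auto simp: \<theta>_def)
    define B where "B = {j\<in>A. 0 < a j}"
    have "sum \<theta> A = card B"
      using fin by (simp add: \<theta> sum.If_cases B_def Int_def cong: sum.cong)
    moreover have "card B \<le> m"
    proof (rule ccontr)
      assume "\<not> card B \<le> m"
      then have "B \<noteq> {}" "finite B" using fin by (fastforce, simp add: B_def)
      \<comment> \<open>With more than \<open>m\<close> positive loads, the least of them would be a
        positive feasible level, against the level being 0.\<close>
      define h where "h = Min (a ` B)"
      have hpos: "h > 0" using \<open>B \<noteq> {}\<close> \<open>finite B\<close> by (simp add: h_def B_def)
      have "real m * h \<le> real (card B) * h" using \<open>\<not> card B \<le> m\<close> hpos by simp
      also have "\<dots> = (\<Sum>j\<in>B. h)" by simp
      also have "\<dots> = (\<Sum>j\<in>B. min (a j) h)"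
        by (intro sum.cong) (use \<open>finite B\<close> in \<open>auto simp: h_def min_absorb2\<close>)
      also have "\<dots> \<le> (\<Sum>j\<in>A. min (a j) h)"
        by (intro sum_mono2) (use fin hpos a in \<open>auto simp: B_def\<close>)
      finally have "h \<le> ?h" by (intro pool_level_upper[OF fin m a]) (use hpos in auto)
      then show False using True hpos by simp
    qed
    moreover have "(\<Sum>j\<in>A. \<theta> j * s j powr \<alpha>) = chen_energy \<alpha> m A a"
      unfolding energy using True a s \<theta> by (auto intro!: sum.cong)
    ultimately show ?thesis by simp
  next
    case False
    then have hp: "?h > 0" using h0 by simp
    have sp: "s j > 0" for j using sa(2)[of j] hp by simp
    \<comment> \<open>With a positive level, the total of the shares is the balance equation divided
      by the level, hence exactly \<open>m\<close>.\<close>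
    have \<theta>: "\<theta> j = min (a j) ?h / ?h" for j
      using hp by (auto simp: \<theta>_def s_def chen_speed_def min_def max_def)
    have sum\<theta>: "sum \<theta> A = real m"
      using pool_level_eq[OF fin m a] hp by (simp add: \<theta> flip: sum_divide_distrib)
    have "\<theta> j * s j powr \<alpha> = \<theta> j * ?h powr \<alpha> + (s j powr \<alpha> - ?h powr \<alpha>)" for j
      using hp by (auto simp: \<theta> s_def chen_speed_def min_def max_def algebra_simps)
    then have "(\<Sum>j\<in>A. \<theta> j * s j powr \<alpha>) = sum \<theta> A * ?h powr \<alpha> + (\<Sum>j\<in>A. s j powr \<alpha> - ?h powr \<alpha>)"
      by (simp add: sum.distrib sum_distrib_right)
    then show ?thesis using sum\<theta> energy by simp
  qed
  then show "sum \<theta> A \<le> real m" "(\<Sum>j\<in>A. \<theta> j * s j powr \<alpha>) = chen_energy \<alpha> m A a" by auto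
qed

text \<open>The maximum over such weights is attained by the shares of \<open>a\<close> itself.\<close>

lemma weighted_speeds_le_chen_energy:
  assumes fin: "finite A" and m: "m \<ge> 1" and a: "\<forall>j\<in>A. 0 \<le> a j" and "\<alpha> > 1"
    and \<theta>: "\<forall>j\<in>A. 0 \<le> \<theta> j \<and> \<theta> j \<le> 1" "sum \<theta> A \<le> real m"
  shows "(\<Sum>j\<in>A. \<theta> j * chen_speed m A a j powr \<alpha>) \<le> chen_energy \<alpha> m A a"
proof -
  let ?h = "pool_level m A a" and ?s = "chen_speed m A a"
  have h0: "0 \<le> ?h" by (rule pool_level_nonneg[OF fin m a])
  have le: "?h powr \<alpha> \<le> ?s j powr \<alpha>" for j
    using h0 \<open>\<alpha> > 1\<close> by (intro powr_mono2) (auto simp: chen_speed_def)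
  \<comment> \<open>The power splits into the pool part, whose weights total at most
    \<open>m\<close>, and the surplus over the pool, where each weight is at most 1.\<close>
  have "\<theta> j * ?s j powr \<alpha> \<le> \<theta> j * ?h powr \<alpha> + (?s j powr \<alpha> - ?h powr \<alpha>)" if "j \<in> A" for j
    using mult_right_mono[of "\<theta> j" 1 "?s j powr \<alpha> - ?h powr \<alpha>"] bspec[OF \<theta>(1) that] le[of j]
    by (simp add: algebra_simps)
  then have "(\<Sum>j\<in>A. \<theta> j * ?s j powr \<alpha>) \<le> (\<Sum>j\<in>A. \<theta> j * ?h powr \<alpha> + (?s j powr \<alpha> - ?h powr \<alpha>))"
    by (intro sum_mono)
  also have "\<dots> = sum \<theta> A * ?h powr \<alpha> + (\<Sum>j\<in>A. ?s j powr \<alpha> - ?h powr \<alpha>)"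
    by (simp add: sum.distrib sum_distrib_right)
  also have "\<dots> \<le> chen_energy \<alpha> m A a"
    unfolding chen_energy_def using \<theta>(2) by (simp add: mult_right_mono)
  finally show ?thesis .
qed

section \<open>Convexity of the energy through Young's inequality\<close>

lemma powr_diff_one_mult:
  fixes x :: real
  shows "0 \<le> x \<Longrightarrow> x powr (\<alpha> - 1) * x = x powr \<alpha>"
  by (cases "x = 0") (auto simp: powr_diff)

text \<open>The tangent to the power function at \<open>s\<close> lies below its graph. This
  inequality is used both for convexity and for duality.\<close>

lemma Young_powr:
  fixes s t :: real
  assumes "\<alpha> > 1" "0 \<le> s" "0 \<le> t"
  shows "\<alpha> * s powr (\<alpha> - 1) * t \<le> t powr \<alpha> + (\<alpha> - 1) * s powr \<alpha>"
proof -
  define p q where "p = \<alpha>" and "q = \<alpha> / (\<alpha> - 1)"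
  have "t * s powr (\<alpha> - 1) \<le> t powr p / p + (s powr (\<alpha> - 1)) powr q / q"
    by (rule Youngs_inequality) (use assms in \<open>auto simp: p_def q_def field_simps\<close>)
  also have "(s powr (\<alpha> - 1)) powr q = s powr \<alpha>" using assms by (simp add: powr_powr q_def)
  finally show ?thesis using assms by (simp add: p_def q_def field_simps)
qed

text \<open>Young's inequality at the speeds of \<open>a\<close> is averaged with the shares of
  \<open>b\<close>. The powers of the speeds of \<open>b\<close> then total the energy of
  \<open>b\<close>, while those of \<open>a\<close> total at most the energy of \<open>a\<close>,
  because the shares of \<open>b\<close> are admissible weights.\<close>

lemma chen_energy_subgradient:
  assumes fin: "finite A" and m: "m \<ge> 1" and a: "\<forall>j\<in>A. 0 \<le> a j"
    and b: "\<forall>j\<in>A. 0 \<le> b j" and \<alpha>: "\<alpha> > 1"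
  shows "chen_energy \<alpha> m A a + (\<Sum>j\<in>A. \<alpha> * chen_speed m A a j powr (\<alpha> - 1) * (b j - a j))
    \<le> chen_energy \<alpha> m A b"
proof -
  let ?s = "chen_speed m A a" and ?t = "chen_speed m A b"
  let ?\<theta> = "\<lambda>j. a j / ?s j" and ?\<eta> = "\<lambda>j. b j / ?t j"
  note wa = chen_weights[OF fin m a \<alpha>] and wb = chen_weights[OF fin m b \<alpha>]
  note s0 = chen_speed_nonneg[OF fin m a] and t0 = chen_speed_nonneg[OF fin m b]
  \<comment> \<open>Euler's identity for a function homogeneous of degree \<open>\<alpha>\<close>:
    the gradient applied to the point itself is \<open>\<alpha>\<close> times the energy.\<close>
  have "(\<Sum>j\<in>A. \<alpha> * ?s j powr (\<alpha> - 1) * a j) = (\<Sum>j\<in>A. \<alpha> * (?\<theta> j * ?s j powr \<alpha>))"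
  proof (rule sum.cong)
    fix j assume "j \<in> A"
    then have "\<alpha> * ?s j powr (\<alpha> - 1) * a j = \<alpha> * ?\<theta> j * (?s j powr (\<alpha> - 1) * ?s j)"
      by (subst (1) wa(1)[OF \<open>j \<in> A\<close>, THEN conjunct2, THEN conjunct2, symmetric]) simp
    also have "?s j powr (\<alpha> - 1) * ?s j = ?s j powr \<alpha>"
      by (rule powr_diff_one_mult[OF s0])
    finally show "\<alpha> * ?s j powr (\<alpha> - 1) * a j = \<alpha> * (?\<theta> j * ?s j powr \<alpha>)" by simp
  qed simp
  also have "\<dots> = \<alpha> * chen_energy \<alpha> m A a" unfolding sum_distrib_left[symmetric] wa(3) ..
  finally have ea: "(\<Sum>j\<in>A. \<alpha> * ?s j powr (\<alpha> - 1) * a j) = \<alpha> * chen_energy \<alpha> m A a" .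
  have "(\<Sum>j\<in>A. \<alpha> * ?s j powr (\<alpha> - 1) * b j)
    \<le> (\<Sum>j\<in>A. ?\<eta> j * ?t j powr \<alpha> + (\<alpha> - 1) * (?\<eta> j * ?s j powr \<alpha>))"
  proof (rule sum_mono)
    fix j assume j: "j \<in> A"
    have "\<alpha> * ?s j powr (\<alpha> - 1) * b j = ?\<eta> j * (\<alpha> * ?s j powr (\<alpha> - 1) * ?t j)"
      by (subst (1) wb(1)[OF j, THEN conjunct2, THEN conjunct2, symmetric]) simp
    also have "\<dots> \<le> ?\<eta> j * (?t j powr \<alpha> + (\<alpha> - 1) * ?s j powr \<alpha>)"
      using Young_powr[OF \<alpha> s0 t0] wb(1)[OF j] by (intro mult_left_mono) auto
    finally show "\<alpha> * ?s j powr (\<alpha> - 1) * b j \<le> ?\<eta> j * ?t j powr \<alpha> + (\<alpha> - 1) * (?\<eta> j * ?s j powr \<alpha>)"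
      by (simp only: distrib_left mult_ac)
  qed
  also have "\<dots> = chen_energy \<alpha> m A b + (\<alpha> - 1) * (\<Sum>j\<in>A. ?\<eta> j * ?s j powr \<alpha>)"
    using wb(3) by (simp add: sum.distrib sum_distrib_left)
  also have "\<dots> \<le> chen_energy \<alpha> m A b + (\<alpha> - 1) * chen_energy \<alpha> m A a"
    using weighted_speeds_le_chen_energy[OF fin m a \<alpha>, of ?\<eta>] wb(1,2) \<alpha> by simp
  finally show ?thesis using ea by (simp add: sum_subtractf right_diff_distrib algebra_simps)
qed

text \<open>The same averaging with the tangent at the constant speed \<open>c\<close> of
  \<open>m\<close> processors sharing the load evenly; the constant terms have total weight at most
  \<open>m\<close>.\<close>

lemma chen_energy_ge_average:
  assumes fin: "finite A" and m: "m \<ge> 1" and a: "\<forall>j\<in>A. 0 \<le> a j" and \<alpha>: "\<alpha> > 1"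
  shows "real m * (sum a A / real m) powr \<alpha> \<le> chen_energy \<alpha> m A a"
proof -
  define c where "c = sum a A / real m"
  have c0: "0 \<le> c" using a m by (auto simp: c_def intro!: divide_nonneg_nonneg sum_nonneg)
  let ?s = "chen_speed m A a"
  let ?\<theta> = "\<lambda>j. a j / ?s j"
  note wa = chen_weights[OF fin m a \<alpha>] and s0 = chen_speed_nonneg[OF fin m a]
  have "\<alpha> * c powr (\<alpha> - 1) * sum a A = (\<Sum>j\<in>A. ?\<theta> j * (\<alpha> * c powr (\<alpha> - 1) * ?s j))"
    unfolding sum_distrib_left
  proof (rule sum.cong[OF refl])
    fix j assume "j \<in> A"
    then show "\<alpha> * c powr (\<alpha> - 1) * a j = ?\<theta> j * (\<alpha> * c powr (\<alpha> - 1) * ?s j)"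
      by (subst (1) wa(1)[THEN conjunct2, THEN conjunct2, symmetric]) simp_all
  qed
  also have "\<dots> \<le> (\<Sum>j\<in>A. ?\<theta> j * (?s j powr \<alpha> + (\<alpha> - 1) * c powr \<alpha>))"
    using Young_powr[OF \<alpha> c0 s0] wa(1) by (intro sum_mono mult_left_mono) auto
  also have "\<dots> = chen_energy \<alpha> m A a + (\<alpha> - 1) * c powr \<alpha> * sum ?\<theta> A"
    using wa(3) by (simp add: sum.distrib distrib_left sum_distrib_left mult_ac)
  also have "\<dots> \<le> chen_energy \<alpha> m A a + (\<alpha> - 1) * c powr \<alpha> * real m"
    using wa(2) \<alpha> by (intro add_left_mono mult_left_mono) auto
  also have "\<alpha> * c powr (\<alpha> - 1) * sum a A = \<alpha> * real m * c powr \<alpha>"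
  proof -
    have "c powr (\<alpha> - 1) * c = c powr \<alpha>"
      by (rule powr_diff_one_mult[OF c0])
    moreover have "sum a A = c * real m" using m by (simp add: c_def)
    ultimately show ?thesis by (simp add: mult_ac)
  qed
  finally show ?thesis by (simp add: c_def algebra_simps)
qed

text \<open>Subgradients at both ends trap the difference quotient between \<open>g z\<close> and
  \<open>g y\<close>, and continuity of \<open>g\<close> closes the gap. Working within
  \<open>S\<close> covers one-sided derivatives at the boundary.\<close>

lemma has_real_derivative_sandwich:
  fixes f g :: "real \<Rightarrow> real"
  assumes z: "z \<in> S" and g: "continuous_on S g"
    and sub: "\<And>x y. x \<in> S \<Longrightarrow> y \<in> S \<Longrightarrow> f x + g x * (y - x) \<le> f y"
  shows "(f has_real_derivative g z) (at z within S)"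
proof -
  have lim: "((\<lambda>y. \<bar>g y - g z\<bar>) \<longlongrightarrow> 0) (at z within S)"
    using g z by (auto simp: continuous_on_def intro!: tendsto_rabs_zero LIM_zero)
  have "\<bar>(f y - f z) / (y - z) - g z\<bar> \<le> \<bar>g y - g z\<bar>" if "y \<in> S" "y \<noteq> z" for y
  proof -
    have "g z * (y - z) \<le> f y - f z" "f y - f z \<le> g y * (y - z)"
      using sub[OF z that(1)] sub[OF that(1) z] by (auto simp: algebra_simps)
    then have "g z \<le> (f y - f z) / (y - z) \<and> (f y - f z) / (y - z) \<le> g y" if "y > z"
      using that by (simp add: pos_le_divide_eq pos_divide_le_eq)
    moreover have "g y \<le> (f y - f z) / (y - z) \<and> (f y - f z) / (y - z) \<le> g z" if "y < z"
      using that \<open>g z * (y - z) \<le> _\<close> \<open>_ \<le> g y * (y - z)\<close>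
      by (simp add: neg_le_divide_eq neg_divide_le_eq)
    ultimately show ?thesis using that(2) by (cases "y < z") auto
  qed
  then have "((\<lambda>y. (f y - f z) / (y - z) - g z) \<longlongrightarrow> 0) (at z within S)"
    by (intro Lim_null_comparison[OF _ lim]) (auto simp: eventually_at_filter)
  then show ?thesis
    unfolding has_field_derivative_iff by (rule LIM_zero_cancel)
qed

section \<open>Energy of an atomic interval\<close>

text \<open>A certificate for a proposed dedicated set: the balance equation holds at the average
  \<open>h\<close> of the other loads, and above \<open>h\<close> only the jobs of \<open>D\<close>
  can still gain, which are fewer than \<open>m\<close>.\<close>

lemma chen_energy_split:
  assumes fin: "finite A" and m: "m \<ge> 1" and a: "\<forall>j\<in>A. 0 \<le> a j"
    and D: "D \<subseteq> A" "card D < m" and h: "h = sum a (A - D) / (real m - real (card D))"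
    and hD: "\<forall>j\<in>D. h \<le> a j" and hP: "\<forall>j\<in>A - D. a j \<le> h"
  shows "chen_energy \<alpha> m A a = (\<Sum>j\<in>D. a j powr \<alpha>) + (real m - real (card D)) * h powr \<alpha>"
proof -
  have finD: "finite D" using fin D(1) by (rule finite_subset[rotated])
  have split: "sum f A = sum f D + sum f (A - D)" for f :: "'a \<Rightarrow> real"
    using sum.subset_diff[OF D(1) fin] by (simp add: add.commute)
  have p: "real m - real (card D) > 0" using D(2) by simp
  have pool: "sum a (A - D) = (real m - real (card D)) * h" using p by (simp add: h)
  have h0: "0 \<le> h" using p a by (auto simp: h intro!: divide_nonneg_pos sum_nonneg)
  have "pool_level m A a = h"
  proof (rule pool_level_unique[OF fin m a h0])
    have "(\<Sum>j\<in>D. min (a j) h) = (\<Sum>j\<in>D. h)" using hD by (intro sum.cong) (auto simp: min_absorb2)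
    moreover have "(\<Sum>j\<in>A - D. min (a j) h) = sum a (A - D)"
      using hP by (intro sum.cong) (auto simp: min_absorb1)
    ultimately show "real m * h \<le> (\<Sum>j\<in>A. min (a j) h)"
      unfolding split[of "\<lambda>j. min (a j) h"] pool by (simp add: algebra_simps)
  next
    fix h' assume h': "h < h'"
    have "(\<Sum>j\<in>D. min (a j) h') \<le> (\<Sum>j\<in>D. h')" by (intro sum_mono) auto
    moreover have "(\<Sum>j\<in>A - D. min (a j) h') \<le> sum a (A - D)" by (intro sum_mono) auto
    moreover have "(real m - real (card D)) * h < (real m - real (card D)) * h'" using h' p by simp
    ultimately show "(\<Sum>j\<in>A. min (a j) h') < real m * h'"
      unfolding split[of "\<lambda>j. min (a j) h'"] pool by (simp add: algebra_simps)
  qed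
  then have "chen_energy \<alpha> m A a = real m * h powr \<alpha> + (\<Sum>j\<in>A. max (a j) h powr \<alpha> - h powr \<alpha>)"
    by (simp add: chen_energy_def chen_speed_def)
  also have "(\<Sum>j\<in>A. max (a j) h powr \<alpha> - h powr \<alpha>) = (\<Sum>j\<in>D. a j powr \<alpha> - h powr \<alpha>) + 0"
    unfolding split[of "\<lambda>j. max (a j) h powr \<alpha> - h powr \<alpha>"]
    using hD hP by (intro arg_cong2[of _ _ _ _ plus] sum.cong sum.neutral) (auto simp: max_absorb1 max_absorb2)
  finally show ?thesis by (simp add: sum_subtractf algebra_simps)
qed

section \<open>Chen et al.'s dedicated jobs\<close>

lemma load_order_props:
  shows set_load_order: "set (load_order J x) = {..<length J}"
    and distinct_load_order: "distinct (load_order J x)"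
    and length_load_order: "length (load_order J x) = length J"
    and load_order_decreasing: "p \<le> q \<Longrightarrow> q < length J \<Longrightarrow>
      load J x (load_order J x ! q) \<le> load J x (load_order J x ! p)"
proof -
  show "set (load_order J x) = {..<length J}" "distinct (load_order J x)"
    and len: "length (load_order J x) = length J"
    by (auto simp: load_order_def)
  have "sorted (map (\<lambda>j. - load J x j) (load_order J x))"
    unfolding load_order_def by (rule sorted_sort_key)
  then show "p \<le> q \<Longrightarrow> q < length J \<Longrightarrow>
      load J x (load_order J x ! q) \<le> load J x (load_order J x ! p)"
    using len by (auto simp: sorted_iff_nth_mono)
qed

text \<open>Since the dedicated ranks form an initial segment, comparing the last dedicated and the first
  other rank with the pool speed suffices.\<close>

lemma dedicated_pool_speed:
  assumes m: "m \<ge> 1" and x: "\<forall>j<length J. 0 \<le> x j" and w: "\<forall>j<length J. 0 < workload (J ! j)"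
  defines "D \<equiv> dedicated m J x"
  defines "h \<equiv> (\<Sum>j\<in>{..<length J} - D. load J x j) / (real m - real (card D))"
  shows "D \<subseteq> {..<length J}" "card D < m"
    "\<forall>j\<in>D. h \<le> load J x j" "\<forall>j\<in>{..<length J} - D. load J x j \<le> h"
proof -
  let ?n = "length J"
  define r where "r = load_order J x"
  define L where "L p = load J x (r ! p)" for p
  define Q where "Q p \<longleftrightarrow> p < ?n \<and> p + 1 < m \<and> 0 < x (r ! p) \<and>
     (\<Sum>q\<in>{p<..<?n}. L q) / (real m - real (p + 1)) \<le> L p" for p
  have D: "D = (\<lambda>p. r ! p) ` {p. Q p}" unfolding D_def dedicated_def Q_def L_def r_def by auto
  have rset: "set r = {..<?n}" and rdist: "distinct r" and rlen: "length r = ?n"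
    using load_order_props[where J = J and x = x] by (auto simp: r_def)
  have rn: "r ! p < ?n" if "p < ?n" for p using that rset rlen nth_mem[of p r] by auto
  have L0: "0 \<le> L p" if "p < ?n" for p
    unfolding L_def load_def using x w rn[OF that] by (simp add: less_imp_le)
  have dec: "L q \<le> L p" if "p \<le> q" "q < ?n" for p q
    using load_order_props(4)[where J = J and x = x, OF that] by (simp add: L_def r_def)
  define T where "T p = (\<Sum>q\<in>{p..<?n}. L q)" for p
  have T: "T p = L p + (\<Sum>q\<in>{p<..<?n}. L q)" if "p < ?n" for p
    unfolding T_def using that
    by (simp add: sum.atLeast_Suc_lessThan atLeastSucLessThan_greaterThanLessThan)
  \<comment> \<open>Adding \<open>L p\<close> to both sides replaces the tail after rank
    \<open>p\<close> by the tail from \<open>p\<close> on, and the factor \<open>m - (p + 1)\<close>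
    by \<open>m - p\<close>.\<close>
  have Qiff: "Q p \<longleftrightarrow> p + 1 < m \<and> 0 < x (r ! p) \<and> T p \<le> (real m - real p) * L p" if "p < ?n" for p
    unfolding Q_def T[OF that] using that
    by (auto simp: divide_le_eq algebra_simps)
  have Qdown: "Q p" if "Q (Suc p)" for p
  proof -
    have p: "Suc p < ?n" "Suc p + 1 < m" "0 < x (r ! Suc p)" using that by (auto simp: Q_def)
    have "0 < L (Suc p)" unfolding L_def load_def using p(3) w rn[OF p(1)] by simp
    then have "0 < L p" using dec[of p "Suc p"] p(1) by simp
    then have "0 < x (r ! p)"
      using x w rn[of p] p(1) by (auto simp: L_def load_def zero_less_mult_iff dest: less_asym)
    moreover have "T p = L p + T (Suc p)" unfolding T_def using p(1) by (simp add: sum.atLeast_Suc_lessThan)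
    moreover have "T (Suc p) \<le> (real m - real (Suc p)) * L (Suc p)" using that Qiff[OF p(1)] by blast
    moreover have "(real m - real (Suc p)) * L (Suc p) \<le> (real m - real (Suc p)) * L p"
      using p dec[of p "Suc p"] by (intro mult_left_mono) auto
    ultimately show ?thesis using Qiff[of p] p by (auto simp: algebra_simps)
  qed
  \<comment> \<open>The first rank that fails the test; by downward closure it is also the number of
    dedicated jobs.\<close>
  define d where "d = (LEAST p. \<not> Q p)"
  have nQd: "\<not> Q d" unfolding d_def by (rule LeastI[of _ ?n]) (simp add: Q_def)
  have Qless: "Q p" if "p < d" for p using not_less_Least that unfolding d_def by blast
  have nQ: "\<not> Q p" if "d \<le> p" for p
    using that by (induction p rule: dec_induct) (use nQd Qdown in auto)
  have Qset: "{p. Q p} = {..<d}" using Qless nQ by (auto simp: not_less[symmetric])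
  have dn: "d \<le> ?n" using Qless[of ?n] by (auto simp: Q_def not_less[symmetric])
  have dm: "d < m" using m Qless[of "d - 1"] by (cases d) (auto simp: Q_def)
  have inj: "inj_on (\<lambda>p. r ! p) {..<?n}" using rdist rlen by (auto simp: inj_on_def nth_eq_iff_index_eq)
  have img: "(\<lambda>p. r ! p) ` {..<?n} = {..<?n}"
    using rset rlen by (auto simp: set_conv_nth image_def)
  have Dd: "D = (\<lambda>p. r ! p) ` {..<d}" using D Qset by simp
  have cardD: "card D = d"
    unfolding Dd by (subst card_image) (use inj dn in \<open>auto intro: inj_on_subset\<close>)
  have compl: "{..<?n} - D = (\<lambda>p. r ! p) ` {d..<?n}"
  proof -
    have "{..<?n} - D = (\<lambda>p. r ! p) ` ({..<?n} - {..<d})"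
      unfolding Dd by (subst (1) img[symmetric], subst inj_on_image_set_diff[OF inj]) (use dn in auto)
    moreover have "{..<?n} - {..<d} = {d..<?n}" by auto
    ultimately show ?thesis by simp
  qed
  have "(\<Sum>j\<in>{..<?n} - D. load J x j) = T d"
    unfolding compl T_def L_def
    by (subst sum.reindex) (auto intro: inj_on_subset[OF inj])
  then have h: "h = T d / (real m - real d)" by (simp add: h_def cardD)
  show "D \<subseteq> {..<?n}" using Dd img dn by auto
  show "card D < m" using cardD dm by simp
  show "\<forall>j\<in>D. h \<le> load J x j"
  proof
    fix j assume "j \<in> D"
    then obtain p where p: "p < d" "j = r ! p" using Dd by auto
    have d1: "d - 1 < ?n" "Suc (d - 1) = d" using p dn by auto
    \<comment> \<open>Splitting the last dedicated load off its tail lowers the factor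
      \<open>m - (d - 1)\<close> to \<open>m - d\<close>, which is the comparison with the pool
      average.\<close>
    have "T (d - 1) \<le> (real m - real (d - 1)) * L (d - 1)"
      using Qless[of "d - 1"] Qiff[OF d1(1)] p(1) by auto
    moreover have "T (d - 1) = L (d - 1) + T d"
      unfolding T_def using d1 by (metis sum.atLeast_Suc_lessThan)
    moreover have "real (d - 1) = real d - 1" using p(1) by simp
    ultimately have "T d \<le> (real m - real d) * L (d - 1)" by (simp add: algebra_simps)
    then have "h \<le> L (d - 1)" using dm by (simp add: h divide_le_eq mult.commute)
    also have "\<dots> \<le> L p" using dec[of p "d - 1"] p d1 by auto
    finally show "h \<le> load J x j" by (simp add: L_def p)
  qed
  show "\<forall>j\<in>{..<?n} - D. load J x j \<le> h"
  proof
    fix j assume "j \<in> {..<?n} - D"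
    then obtain p where p: "d \<le> p" "p < ?n" "j = r ! p" using compl by auto
    have Tpos: "L d \<le> T d" unfolding T[OF le_less_trans[OF p(1,2)]] using L0 by (auto intro!: sum_nonneg)
    have T0: "0 \<le> T d" unfolding T_def using L0 by (auto intro!: sum_nonneg)
    have "(real m - real d) * L d \<le> T d"
    proof -
      \<comment> \<open>Rank \<open>d\<close> fails because one processor is left, because its
        portion is 0, or because its load is below the threshold. In the first case \<open>h\<close>
        is the entire remaining load.\<close>
      consider "d + 1 = m" | "x (r ! d) \<le> 0" | "T d > (real m - real d) * L d"
        using nQd Qiff[of d] dm p by force
      then show ?thesis
      proof cases
        case 1
        then have "real m - real d = 1" by simp
        then show ?thesis using Tpos by simp
      next
        case 2
        then have "L d = 0"
          using x rn[of d] p unfolding L_def load_def by (auto simp: antisym)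
        then show ?thesis using T0 by simp
      qed simp
    qed
    then have "L d \<le> h" using dm by (simp add: h le_divide_eq mult.commute)
    then show "load J x j \<le> h" using dec[OF p(1,2)] by (simp add: L_def p)
  qed
qed

section \<open>Interval energy and its derivative in one portion\<close>

definition unit_load :: "job list \<Rightarrow> nat \<Rightarrow> (nat \<Rightarrow> real) \<Rightarrow> nat \<Rightarrow> real" where
  "unit_load J k x j = load J x j / interval_length J k"

lemma unit_load_update:
  "unit_load J k (x(j := z)) = (unit_load J k x)(j := z * (workload (J ! j) / interval_length J k))"
  by (auto simp: unit_load_def load_def)

text \<open>Dividing loads by the length turns them into speeds, and the dedicated jobs of the model
  satisfy the certificate of \<open>chen_energy_split\<close>.\<close>

lemma interval_energy_eq:
  assumes m: "m \<ge> 1" and x: "\<forall>j<length J. 0 \<le> x j" and w: "\<forall>j<length J. 0 < workload (J ! j)"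
    and l: "0 < interval_length J k"
  shows "interval_energy \<alpha> m J k x =
    interval_length J k * chen_energy \<alpha> m {..<length J} (unit_load J k x)"
proof -
  let ?l = "interval_length J k" and ?A = "{..<length J}" and ?a = "unit_load J k x"
  define D where "D = dedicated m J x"
  define p where "p = real m - real (card D)"
  note ded = dedicated_pool_speed[OF m x w, folded D_def]
  have p: "p > 0" using ded(2) by (simp add: p_def)
  have a: "\<forall>j\<in>?A. 0 \<le> ?a j" using x w l by (auto simp: unit_load_def load_def less_imp_le)
  have sum_a: "sum ?a (?A - D) = (\<Sum>j\<in>?A - D. load J x j) / ?l"
    by (simp add: unit_load_def sum_divide_distrib)
  have "chen_energy \<alpha> m ?A ?a =
    (\<Sum>j\<in>D. ?a j powr \<alpha>) + p * ((\<Sum>j\<in>?A - D. load J x j) / (p * ?l)) powr \<alpha>"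
    unfolding p_def
  proof (rule chen_energy_split[OF _ m a ded(1,2)])
    show h: "(\<Sum>j\<in>?A - D. load J x j) / ((real m - real (card D)) * ?l) =
      sum ?a (?A - D) / (real m - real (card D))"
      by (simp add: sum_a mult.commute)
    show "\<forall>j\<in>D. (\<Sum>j\<in>?A - D. load J x j) / ((real m - real (card D)) * ?l) \<le> ?a j"
      using ded(3) l by (auto simp: unit_load_def divide_le_cancel simp flip: divide_divide_eq_left)
    show "\<forall>j\<in>?A - D. ?a j \<le> (\<Sum>j\<in>?A - D. load J x j) / ((real m - real (card D)) * ?l)"
      using ded(4) l by (auto simp: unit_load_def divide_le_cancel simp flip: divide_divide_eq_left)
  qed simp
  then show ?thesis
    unfolding interval_energy_def Let_def D_def[symmetric] p_def[symmetric]
    by (simp add: unit_load_def distrib_left sum_distrib_left mult_ac)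
qed

lemma trivial_limit_at_within_atLeast: "0 \<le> (z::real) \<Longrightarrow> at z within {0..} \<noteq> bot"
  by (cases "z = 0") (auto simp: at_within_Ici_at_right at_within_interior[of z "{0..}"])

text \<open>Only coordinate \<open>j\<close> of the subgradient survives, and the length in front of
  the energy cancels the one dividing the load.\<close>

lemma interval_energy_update_subgradient:
  assumes m: "m \<ge> 1" and \<alpha>: "\<alpha> > 1" and j: "j < length J" and x: "\<forall>i<length J. 0 \<le> x i"
    and w: "\<forall>j<length J. 0 < workload (J ! j)" and l: "0 < interval_length J k"
    and y: "0 \<le> y" "0 \<le> y'"
  shows "interval_energy \<alpha> m J k (x(j := y)) + \<alpha> * workload (J ! j) *
      chen_speed m {..<length J} (unit_load J k (x(j := y))) j powr (\<alpha> - 1) * (y' - y)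
    \<le> interval_energy \<alpha> m J k (x(j := y'))"
proof -
  let ?A = "{..<length J}" and ?l = "interval_length J k"
  define b where "b = unit_load J k (x(j := y))"
  define b' where "b' = unit_load J k (x(j := y'))"
  have nonneg: "\<forall>i\<in>?A. 0 \<le> unit_load J k (x(j := z)) i" if "0 \<le> z" for z
    using x w l that by (auto simp: unit_load_def load_def less_imp_le)
  have E: "interval_energy \<alpha> m J k (x(j := z)) = ?l * chen_energy \<alpha> m ?A (unit_load J k (x(j := z)))"
    if "0 \<le> z" for z
    by (rule interval_energy_eq[OF m _ w l]) (use x that in auto)
  have "chen_energy \<alpha> m ?A b +
      (\<Sum>i\<in>?A. \<alpha> * chen_speed m ?A b i powr (\<alpha> - 1) * (b' i - b i)) \<le> chen_energy \<alpha> m ?A b'"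
    unfolding b_def b'_def by (rule chen_energy_subgradient[OF _ m nonneg nonneg \<alpha>]) (use y in auto)
  also have "(\<Sum>i\<in>?A. \<alpha> * chen_speed m ?A b i powr (\<alpha> - 1) * (b' i - b i)) =
      (\<Sum>i\<in>{j}. \<alpha> * chen_speed m ?A b i powr (\<alpha> - 1) * (b' i - b i))"
    using j by (intro sum.mono_neutral_right) (auto simp: b_def b'_def unit_load_update)
  also have "\<dots> = \<alpha> * chen_speed m ?A b j powr (\<alpha> - 1) * (workload (J ! j) / ?l * (y' - y))"
  proof -
    have "b' j - b j = workload (J ! j) / ?l * (y' - y)"
      by (simp add: b_def b'_def unit_load_update left_diff_distrib right_diff_distrib diff_divide_distrib mult.commute)
    then show ?thesis by simp
  qed
  finally have "?l * (chen_energy \<alpha> m ?A b +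
      \<alpha> * chen_speed m ?A b j powr (\<alpha> - 1) * (workload (J ! j) / ?l * (y' - y)))
    \<le> ?l * chen_energy \<alpha> m ?A b'" using l by (intro mult_left_mono) auto
  also have "?l * (chen_energy \<alpha> m ?A b +
      \<alpha> * chen_speed m ?A b j powr (\<alpha> - 1) * (workload (J ! j) / ?l * (y' - y))) =
    ?l * chen_energy \<alpha> m ?A b + \<alpha> * workload (J ! j) * chen_speed m ?A b j powr (\<alpha> - 1) * (y' - y)"
    using l by (simp add: distrib_left)
  finally show ?thesis using E y by (simp add: b_def b'_def)
qed

text \<open>The subgradients depend continuously on the portion, so the energy is differentiable
  with them as derivatives; at \<open>z = 0\<close> this is the right-sided derivative.\<close>

lemma pd_marginal_eq:
  assumes m: "m \<ge> 1" and \<alpha>: "\<alpha> > 1" and j: "j < length J" and X: "\<forall>i<length J. 0 \<le> X i k"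
    and w: "\<forall>j<length J. 0 < workload (J ! j)" and l: "0 < interval_length J k" and z: "0 \<le> z"
  shows "pd_marginal \<alpha> m \<delta> J X j k z = \<delta> * (\<alpha> * workload (J ! j) *
    chen_speed m {..<length J} (unit_load J k ((\<lambda>i. X i k)(j := z))) j powr (\<alpha> - 1))"
proof -
  let ?A = "{..<length J}" and ?x = "\<lambda>i. X i k" and ?l = "interval_length J k"
  define b where "b = unit_load J k ?x"
  define c where "c = workload (J ! j) / ?l"
  have c: "c > 0" using w j l by (simp add: c_def)
  have b: "\<forall>i\<in>?A. 0 \<le> b i" using X w l by (auto simp: b_def unit_load_def load_def less_imp_le)
  have upd: "unit_load J k (?x(j := y)) = b(j := y * c)" for y
    by (simp add: unit_load_update b_def c_def)
  define s where "s y = chen_speed m ?A (unit_load J k (?x(j := y))) j" for y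
  have cont: "continuous_on {0..} s"
  proof -
    have "continuous_on {0..} (\<lambda>z. chen_speed m ?A (b(j := z)) j)"
      by (rule chen_speed_update_continuous[OF _ m b]) (use j in auto)
    moreover have "continuous_on {0..} (\<lambda>y. y * c)" by (intro continuous_intros)
    moreover have "(\<lambda>y. y * c) ` {0..} \<subseteq> {0..}" using c by auto
    ultimately show ?thesis unfolding s_def upd by (rule continuous_on_compose2)
  qed
  have s0: "0 \<le> s y" if "0 \<le> y" for y
    unfolding s_def upd by (rule chen_speed_nonneg[OF _ m]) (use b that c in auto)
  have gcont: "continuous_on {0..} (\<lambda>y. \<alpha> * workload (J ! j) * s y powr (\<alpha> - 1))"
  proof (intro continuous_on_mult continuous_on_const continuous_on_powr' cont ballI conjI impI)
  qed (use \<alpha> s0 in auto)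
  have "((\<lambda>y. interval_energy \<alpha> m J k (?x(j := y))) has_real_derivative
      \<alpha> * workload (J ! j) * s z powr (\<alpha> - 1)) (at z within {0..})"
    by (rule has_real_derivative_sandwich[OF _ gcont])
      (use z interval_energy_update_subgradient[OF m \<alpha> j X w l] in \<open>auto simp: s_def\<close>)
  then have "vector_derivative (\<lambda>y. interval_energy \<alpha> m J k (?x(j := y))) (at z within {0..}) =
      \<alpha> * workload (J ! j) * s z powr (\<alpha> - 1)"
    by (intro vector_derivative_within trivial_limit_at_within_atLeast z)
      (simp add: has_real_derivative_iff_has_vector_derivative)
  then show ?thesis unfolding pd_marginal_def s_def by simp
qed

section \<open>Marginal costs and prices\<close>

text \<open>Here \<open>f\<close> stands for the marginal cost in one interval and \<open>g\<close>
  for PD's level function, the inverse of \<open>f\<close> extended by 0 below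
  \<open>f 0\<close>.\<close>

lemma level_props:
  fixes f :: "real \<Rightarrow> real"
  assumes cont: "continuous_on {0..} f" and strict: "strict_mono_on {0..} f"
    and unb: "\<And>\<mu>. \<exists>z\<ge>0. \<mu> \<le> f z"
    and g_def: "\<And>\<mu>. g \<mu> = (if \<mu> \<le> f 0 then 0 else THE z. 0 \<le> z \<and> f z = \<mu>)"
  shows level_nonneg: "0 \<le> g \<mu>" and level_inverse: "f (g \<mu>) = max \<mu> (f 0)"
    and level_of_value: "0 \<le> z \<Longrightarrow> g (f z) = z"
    and level_mono: "\<mu> \<le> \<nu> \<Longrightarrow> g \<mu> \<le> g \<nu>"
    and level_strict: "0 < g \<mu> \<Longrightarrow> \<mu> < \<nu> \<Longrightarrow> g \<mu> < g \<nu>"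
    and level_continuous: "continuous_on {a..b} g"
proof -
  have inj: "y = z" if "0 \<le> y" "0 \<le> z" "f y = f z" for y z
    using strict_mono_on_eqD[OF strict that(3)] that by auto
  have less: "f y < f z \<longleftrightarrow> y < z" if "0 \<le> y" "0 \<le> z" for y z
    using strict_mono_onD[OF strict, of y z] strict_mono_onD[OF strict, of z y] that
    by (cases y z rule: linorder_cases) auto
  have val: "g (f z) = z" if "0 \<le> z" for z
  proof (cases "z = 0")
    case False
    then have "f 0 < f z" using that by (subst less) auto
    moreover have "(THE y. 0 \<le> y \<and> f y = f z) = z"
      by (rule the_equality) (use that inj in auto)
    ultimately show ?thesis by (simp add: g_def)
  qed (simp add: g_def)
  have ex: "\<exists>z\<ge>0. f z = max \<mu> (f 0)" for \<mu>
  proof -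
    obtain Z where "0 \<le> Z" "max \<mu> (f 0) \<le> f Z" using unb by blast
    moreover have "continuous_on {0..Z} f" using cont by (rule continuous_on_subset) auto
    ultimately have "\<exists>x\<ge>0. x \<le> Z \<and> f x = max \<mu> (f 0)"
      using IVT'[of f 0 "max \<mu> (f 0)" Z] by simp
    then show ?thesis by blast
  qed
  have gmax: "g (max \<mu> (f 0)) = g \<mu>" for \<mu> by (simp add: g_def max_def)
  have inv: "0 \<le> g \<mu> \<and> f (g \<mu>) = max \<mu> (f 0)" for \<mu>
  proof -
    obtain z where z: "0 \<le> z" "f z = max \<mu> (f 0)" using ex[of \<mu>] by blast
    then have "g \<mu> = z" using val[OF z(1)] gmax[of \<mu>] by simp
    then show ?thesis using z by simp
  qed
  show "0 \<le> g \<mu>" "f (g \<mu>) = max \<mu> (f 0)" using inv by auto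
  show "0 \<le> z \<Longrightarrow> g (f z) = z" by (rule val)
  show "g \<mu> \<le> g \<nu>" if "\<mu> \<le> \<nu>"
  proof (rule ccontr)
    assume "\<not> ?thesis"
    then have "f (g \<nu>) < f (g \<mu>)" using inv by (subst less) auto
    then show False using inv that by auto
  qed
  show "g \<mu> < g \<nu>" if "0 < g \<mu>" "\<mu> < \<nu>"
  proof -
    have "f 0 < \<mu>" using that(1) by (auto simp: g_def split: if_splits)
    then have "f (g \<mu>) < f (g \<nu>)" using inv[of \<mu>] inv[of \<nu>] that(2) by auto
    then show ?thesis using less[of "g \<mu>" "g \<nu>"] inv by simp
  qed
  \<comment> \<open>Prices up to \<open>b\<close> are reached by portions up to \<open>Z\<close>,
    and the inverse of a continuous injection on the compact interval \<open>{0..Z}\<close> is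
    continuous.\<close>
  obtain Z where Z: "0 \<le> Z" "max b (f 0) \<le> f Z" using unb by blast
  have "continuous_on (f ` {0..Z}) g"
  proof (rule continuous_on_inv[OF _ compact_Icc])
    show "continuous_on {0..Z} f" using cont by (rule continuous_on_subset) auto
  qed (use val in auto)
  moreover have "continuous_on {a..b} (\<lambda>\<mu>. max \<mu> (f 0))"
    by (intro continuous_on_max continuous_on_id continuous_on_const)
  moreover have "(\<lambda>\<mu>. max \<mu> (f 0)) ` {a..b} \<subseteq> f ` {0..Z}"
  proof
    fix y assume "y \<in> (\<lambda>\<mu>. max \<mu> (f 0)) ` {a..b}"
    then have "f 0 \<le> y" "y \<le> f Z" using Z(2) by auto
    moreover have "continuous_on {0..Z} f" using cont by (rule continuous_on_subset) auto
    ultimately have "\<exists>x\<ge>0. x \<le> Z \<and> f x = y"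
      using IVT'[of f 0 y Z] Z(1) by simp
    then show "y \<in> f ` {0..Z}" by auto
  qed
  ultimately have "continuous_on {a..b} (\<lambda>\<mu>. g (max \<mu> (f 0)))"
    by (rule continuous_on_compose2)
  then show "continuous_on {a..b} g" by (simp only: gmax)
qed

text \<open>Levels are known to grow strictly only in intervals that already receive work; a
  positive total guarantees such an interval.\<close>

lemma sum_less_sum_if_pos:
  fixes f g :: "'a \<Rightarrow> real"
  assumes "finite A" "\<And>i. i \<in> A \<Longrightarrow> f i \<le> g i" "\<And>i. i \<in> A \<Longrightarrow> 0 < f i \<Longrightarrow> f i < g i" "0 < sum f A"
  shows "sum f A < sum g A"
proof -
  obtain i where "i \<in> A" "0 < f i" using assms(4) sum_nonpos[of A f] by (meson linorder_not_less)
  then have "\<exists>i\<in>A. f i < g i" using assms(3) by blast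
  then show ?thesis using assms(1,2) sum_strict_mono_ex1[of A f g] by blast
qed

locale pd_run =
  fixes \<alpha> :: real and m :: nat and \<delta> :: real and J :: "job list"
  assumes \<alpha>: "\<alpha> > 1" and m: "m \<ge> 1" and \<delta>: "\<delta> > 0" and inst: "job_instance J"
begin

abbreviation "jobs \<equiv> {..<length J}"

lemma workload_pos: "\<forall>j<length J. 0 < workload (J ! j)"
  and worth_pos: "\<forall>j<length J. 0 < worth (J ! j)"
  and release_nonneg: "\<forall>j<length J. 0 \<le> release (J ! j)"
  using inst by (auto simp: job_instance_def)

lemma time_points_less: "k < k' \<Longrightarrow> k' < length (time_points J) \<Longrightarrow> time_points J ! k < time_points J ! k'"
  unfolding time_points_def
  by (rule sorted_wrt_nth_less[OF strict_sorted_list_of_set])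

lemma interval_length_pos: "k < num_intervals J \<Longrightarrow> 0 < interval_length J k"
  unfolding interval_length_def num_intervals_def using time_points_less[of k "k + 1"] by simp

definition assignment :: "(nat \<Rightarrow> nat \<Rightarrow> real) \<Rightarrow> bool" where
  "assignment X \<longleftrightarrow> (\<forall>i<length J. \<forall>k<num_intervals J. 0 \<le> X i k)"

abbreviation "marginal \<equiv> pd_marginal \<alpha> m \<delta> J"
abbreviation "level \<equiv> pd_level \<alpha> m \<delta> J"
abbreviation "raised \<equiv> pd_total \<alpha> m \<delta> J"
abbreviation "accepts \<equiv> pd_accepts \<alpha> m \<delta> J"
abbreviation "price \<equiv> pd_price \<alpha> m \<delta> J"
abbreviation "speed_at X j k z \<equiv> chen_speed m jobs (unit_load J k ((\<lambda>i. X i k)(j := z))) j"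

lemma base_load_nonneg:
  assumes X: "assignment X" and k: "k < num_intervals J"
  shows "\<forall>i\<in>jobs. 0 \<le> unit_load J k (\<lambda>i. X i k) i"
  using X k workload_pos interval_length_pos[OF k]
  by (auto simp: unit_load_def load_def less_imp_le assignment_def)

context
  fixes X j k assumes X: "assignment X" and j: "j < length J" and k: "k < num_intervals J"
begin

definition "ratio = workload (J ! j) / interval_length J k"

lemma ratio_pos: "ratio > 0"
  unfolding ratio_def using workload_pos j interval_length_pos[OF k] by simp

lemma marginal_eq:
  "0 \<le> z \<Longrightarrow> marginal X j k z = \<delta> * (\<alpha> * workload (J ! j) * speed_at X j k z powr (\<alpha> - 1))"
  by (rule pd_marginal_eq[OF m \<alpha> j _ workload_pos interval_length_pos[OF k]])
    (use X k in \<open>auto simp: assignment_def\<close>)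

lemma speed_at_update:
  "speed_at X j k z = chen_speed m jobs ((unit_load J k (\<lambda>i. X i k))(j := z * ratio)) j"
  by (simp add: unit_load_update ratio_def)

lemma speed_at_nonneg: "0 \<le> z \<Longrightarrow> 0 \<le> speed_at X j k z"
  unfolding speed_at_update
  by (rule chen_speed_nonneg[OF _ m]) (use base_load_nonneg[OF X k] ratio_pos in auto)

lemma speed_at_ge: "z * ratio \<le> speed_at X j k z"
  unfolding speed_at_update by (simp add: chen_speed_def)

lemma marginal_zero_nonneg: "0 \<le> marginal X j k 0"
  using marginal_eq[of 0] \<alpha> \<delta> workload_pos j by (simp add: less_imp_le)

lemma marginal_strict_mono: "strict_mono_on {0..} (marginal X j k)"
proof (rule strict_mono_onI)
  fix y z :: real assume yz: "y \<in> {0..}" "z \<in> {0..}" "y < z"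
  have "speed_at X j k y < speed_at X j k z"
    unfolding speed_at_update
    by (rule chen_speed_update_strict_mono[OF _ m base_load_nonneg[OF X k]]) (use j yz ratio_pos in auto)
  then have "speed_at X j k y powr (\<alpha> - 1) < speed_at X j k z powr (\<alpha> - 1)"
    using \<alpha> speed_at_nonneg yz by (intro powr_less_mono2) auto
  then show "marginal X j k y < marginal X j k z"
    using yz \<alpha> \<delta> workload_pos j by (simp add: marginal_eq)
qed

lemma marginal_continuous: "continuous_on {0..} (marginal X j k)"
proof -
  have "continuous_on {0..} (\<lambda>z. chen_speed m jobs ((unit_load J k (\<lambda>i. X i k))(j := z)) j)"
    by (rule chen_speed_update_continuous[OF _ m base_load_nonneg[OF X k]]) (use j in auto)
  moreover have "continuous_on {0..} (\<lambda>y. y * ratio)" by (intro continuous_intros)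
  moreover have "(\<lambda>y. y * ratio) ` {0..} \<subseteq> {0..}" using ratio_pos by auto
  ultimately have cont: "continuous_on {0..} (speed_at X j k)"
    unfolding speed_at_update by (rule continuous_on_compose2)
  have "continuous_on {0..} (\<lambda>z. \<delta> * (\<alpha> * workload (J ! j) * speed_at X j k z powr (\<alpha> - 1)))"
  proof (intro continuous_on_mult continuous_on_const continuous_on_powr' cont ballI conjI impI)
  qed (use \<alpha> speed_at_nonneg in auto)
  then show ?thesis by (rule continuous_on_eq) (simp add: marginal_eq)
qed

lemma marginal_unbounded: "\<exists>z\<ge>0. \<mu> \<le> marginal X j k z"
proof -
  define C where "C = \<delta> * (\<alpha> * workload (J ! j))"
  have C: "C > 0" using \<alpha> \<delta> workload_pos j by (simp add: C_def)
  \<comment> \<open>The speed \<open>u\<close> solves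
    \<open>C * u powr (\<alpha> - 1) = max \<mu> 0\<close>, and the portion \<open>u / ratio\<close>
    alone forces job \<open>j\<close> to run at least that fast.\<close>
  define u where "u = (max \<mu> 0 / C) powr (1 / (\<alpha> - 1))"
  have u: "u powr (\<alpha> - 1) = max \<mu> 0 / C" using \<alpha> C by (simp add: u_def powr_powr)
  have z: "0 \<le> u / ratio" using ratio_pos by (simp add: u_def)
  have "u \<le> speed_at X j k (u / ratio)" using speed_at_ge[of "u / ratio"] ratio_pos by simp
  then have "u powr (\<alpha> - 1) \<le> speed_at X j k (u / ratio) powr (\<alpha> - 1)"
    using \<alpha> by (intro powr_mono2) (auto simp: u_def)
  then have "C * (max \<mu> 0 / C) \<le> C * speed_at X j k (u / ratio) powr (\<alpha> - 1)"
    using C u by (intro mult_left_mono) auto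
  moreover have "C * (max \<mu> 0 / C) = max \<mu> 0" using C by simp
  moreover have "marginal X j k (u / ratio) = C * speed_at X j k (u / ratio) powr (\<alpha> - 1)"
    by (simp add: marginal_eq[OF z] C_def)
  ultimately have "\<mu> \<le> marginal X j k (u / ratio)" by linarith
  then show ?thesis using z by blast
qed

lemma pd_level_unavailable: "\<not> available J j k \<Longrightarrow> level X j k = (\<lambda>\<mu>. 0)"
  by (simp add: pd_level_def fun_eq_iff)

lemmas level_facts =
  level_props[OF marginal_continuous marginal_strict_mono marginal_unbounded, where g = "level X j k"]

lemma pd_level_available:
  "available J j k \<Longrightarrow>
    level X j k \<mu> = (if \<mu> \<le> marginal X j k 0 then 0 else THE z. 0 \<le> z \<and> marginal X j k z = \<mu>)"
  by (simp add: pd_level_def)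

lemma pd_level_nonneg: "0 \<le> level X j k \<mu>"
  using level_facts(1)[OF pd_level_available] by (cases "available J j k") (auto simp: pd_level_unavailable)

lemma marginal_pd_level:
  "available J j k \<Longrightarrow> marginal X j k (level X j k \<mu>) = max \<mu> (marginal X j k 0)"
  by (rule level_facts(2)[OF pd_level_available])

lemma pd_level_marginal: "available J j k \<Longrightarrow> 0 \<le> z \<Longrightarrow> level X j k (marginal X j k z) = z"
  by (rule level_facts(3)[OF pd_level_available])

lemma pd_level_mono: "\<mu> \<le> \<nu> \<Longrightarrow> level X j k \<mu> \<le> level X j k \<nu>"
  using level_facts(4)[OF pd_level_available] by (cases "available J j k") (auto simp: pd_level_unavailable)

lemma pd_level_strict: "0 < level X j k \<mu> \<Longrightarrow> \<mu> < \<nu> \<Longrightarrow> level X j k \<mu> < level X j k \<nu>"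
  using level_facts(5)[OF pd_level_available] by (cases "available J j k") (auto simp: pd_level_unavailable)

lemma pd_level_continuous: "continuous_on {a..b} (level X j k)"
  using level_facts(6)[OF pd_level_available] by (cases "available J j k") (auto simp: pd_level_unavailable)

lemma pd_level_zero: "level X j k 0 = 0"
  using marginal_zero_nonneg by (simp add: pd_level_def)

lemma marginal_pd_level_pos:
  assumes "0 < level X j k \<mu>"
  shows "marginal X j k (level X j k \<mu>) = \<mu>"
proof -
  have "available J j k" using assms by (auto simp: pd_level_def split: if_splits)
  then show ?thesis
    using assms marginal_pd_level[of \<mu>] by (auto simp: pd_level_def split: if_splits)
qed

end

section \<open>Price and acceptance of one job\<close>

context
  fixes X j assumes X: "assignment X" and j: "j < length J"
begin

lemma raised_strict: "0 < raised X j \<mu> \<Longrightarrow> \<mu> < \<nu> \<Longrightarrow> raised X j \<mu> < raised X j \<nu>"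
  unfolding pd_total_def
  by (rule sum_less_sum_if_pos) (use pd_level_mono[OF X j] pd_level_strict[OF X j] in auto)

lemma raised_mono: "\<mu> \<le> \<nu> \<Longrightarrow> raised X j \<mu> \<le> raised X j \<nu>"
  unfolding pd_total_def using pd_level_mono[OF X j] by (intro sum_mono) auto

text \<open>The raised total is strictly increasing wherever it is positive, so it equals 1 at no
  more than one price and the definite description in \<open>pd_price\<close> is determined.\<close>

lemma price_unique:
  assumes "0 \<le> \<mu>" "\<mu> \<le> worth (J ! j)" "raised X j \<mu> = 1"
  shows "accepts X j" "price X j = \<mu>"
proof -
  show acc: "accepts X j" unfolding pd_accepts_def using raised_mono[OF assms(2)] assms(3) by simp
  have "\<nu> = \<mu>" if "raised X j \<nu> = 1" for \<nu>
  proof (rule linorder_cases)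
    assume "\<nu> < \<mu>"
    then show ?thesis using raised_strict[of \<nu> \<mu>] that assms(3) by simp
  next
    assume "\<mu> < \<nu>"
    then show ?thesis using raised_strict[of \<mu> \<nu>] that assms(3) by simp
  qed
  then have "(THE \<mu>. 0 \<le> \<mu> \<and> \<mu> \<le> worth (J ! j) \<and> raised X j \<mu> = 1) = \<mu>"
    using assms by (intro the_equality conjI) blast+
  then show "price X j = \<mu>" unfolding pd_price_def if_P[OF acc] .
qed

text \<open>Nothing is raised at price 0 and at least 1 at the value of the job, so the intermediate
  value theorem supplies a price.\<close>

lemma price_accepted:
  assumes "accepts X j"
  shows "0 \<le> price X j" "price X j \<le> worth (J ! j)" "raised X j (price X j) = 1"
proof -
  have "continuous_on {0..worth (J ! j)} (raised X j)"
    unfolding pd_total_def[abs_def] using pd_level_continuous[OF X j]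
    by (intro continuous_on_sum) auto
  moreover have "raised X j 0 = 0" unfolding pd_total_def using pd_level_zero[OF X j] by simp
  ultimately have "\<exists>\<mu>\<ge>0. \<mu> \<le> worth (J ! j) \<and> raised X j \<mu> = 1"
    using assms worth_pos j IVT'[of "raised X j" 0 1 "worth (J ! j)"]
    unfolding pd_accepts_def by (simp add: less_imp_le)
  then obtain \<mu> where \<mu>: "0 \<le> \<mu>" "\<mu> \<le> worth (J ! j)" "raised X j \<mu> = 1" by blast
  then show "0 \<le> price X j" "price X j \<le> worth (J ! j)" "raised X j (price X j) = 1"
    using price_unique(2)[OF \<mu>] by auto
qed

lemma price_bounds: "0 \<le> price X j" "price X j \<le> worth (J ! j)"
  using price_accepted worth_pos j by (cases "accepts X j", auto simp: pd_price_def less_imp_le)+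

lemma pd_portions_nonneg: "k < num_intervals J \<Longrightarrow> 0 \<le> pd_portions \<alpha> m \<delta> J X j k"
  unfolding pd_portions_def using pd_level_nonneg[OF X j] by simp

end

end

section \<open>Weak duality\<close>

lemma job_speed_measurable:
  assumes "valid_schedule m J S"
  shows "job_speed m S j \<in> borel_measurable borel"
proof -
  have "job_speed m S j = (\<lambda>t. \<Sum>i<m. indicator {t. run S i t = Some j} t * speed S i t)"
  proof
    fix t
    have "(\<Sum>i<m. indicator {t. run S i t = Some j} t * speed S i t) =
      (\<Sum>i<m. if run S i t = Some j then speed S i t else 0)"
      by (intro sum.cong) auto
    also have "\<dots> = sum (\<lambda>i. speed S i t) {i \<in> {..<m}. run S i t = Some j}"
      by (rule sum.inter_filter[symmetric]) simp
    finally show "job_speed m S j t = (\<Sum>i<m. indicator {t. run S i t = Some j} t * speed S i t)"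
      by (simp add: job_speed_def)
  qed
  moreover have "(\<lambda>t. \<Sum>i<m. indicator {t. run S i t = Some j} t * speed S i t) \<in> borel_measurable borel"
    using assms unfolding valid_schedule_def
    by (intro borel_measurable_sum borel_measurable_times borel_measurable_indicator) auto
  ultimately show ?thesis by simp
qed

lemma job_speed_nonneg:
  "valid_schedule m J S \<Longrightarrow> 0 \<le> t \<Longrightarrow> 0 \<le> job_speed m S j t"
  unfolding job_speed_def valid_schedule_def by (intro sum_nonneg) auto

text \<open>Each running job is matched with a processor of its own, so at most \<open>m\<close>
  jobs have nonzero speed. Young's inequality charges such a job to the power of its processor, and
  \<open>C\<close> bounds the conjugate terms.\<close>

lemma job_speeds_pointwise:
  assumes S: "valid_schedule m J S" and t: "0 \<le> t" and \<alpha>: "\<alpha> > 1"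
    and act: "finite act" and \<sigma>: "\<forall>j\<in>act. 0 \<le> \<sigma> j"
    and C: "\<And>M. M \<subseteq> act \<Longrightarrow> card M \<le> m \<Longrightarrow> (\<alpha> - 1) * (\<Sum>j\<in>M. \<sigma> j powr \<alpha>) \<le> C"
  shows "(\<Sum>j\<in>act. \<alpha> * \<sigma> j powr (\<alpha> - 1) * job_speed m S j t) \<le> (\<Sum>i<m. speed S i t powr \<alpha>) + C"
proof -
  let ?s = "\<lambda>j. job_speed m S j t"
  define M where "M = {j \<in> act. \<exists>i<m. run S i t = Some j}"
  have "\<forall>j\<in>M. \<exists>i. i < m \<and> run S i t = Some j" by (auto simp: M_def)
  then obtain f where f: "\<forall>j\<in>M. f j < m \<and> run S (f j) t = Some j"
    by (rule bchoice[THEN exE])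
  have finM: "finite M" using act by (simp add: M_def)
  have inj: "inj_on f M"
  proof (rule inj_onI)
    fix x y assume xy: "x \<in> M" "y \<in> M" "f x = f y"
    have "Some x = Some y" using bspec[OF f xy(1)] bspec[OF f xy(2)] unfolding xy(3) by (auto simp del: option.inject)
    then show "x = y" by simp
  qed
  have "card M = card (f ` M)" using inj by (simp add: card_image)
  also have "\<dots> \<le> card {..<m}" by (intro card_mono) (use f in auto)
  finally have cardM: "card M \<le> m" by simp
  have sM: "?s j = speed S (f j) t" if "j \<in> M" for j
  proof -
    have fj: "f j < m" "run S (f j) t = Some j" using f that by auto
    have V: "\<forall>i<m. \<forall>i'<m. \<forall>t\<ge>0. \<forall>j. run S i t = Some j \<and> run S i' t = Some j \<longrightarrow> i = i'"
      using S by (simp add: valid_schedule_def)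
    have "i = f j" if "i < m" "run S i t = Some j" for i
      by (rule V[rule_format, OF that(1) fj(1) t conjI[OF that(2) fj(2)]])
    then have "{i. i < m \<and> run S i t = Some j} = {f j}" using fj by blast
    then show ?thesis by (simp add: job_speed_def)
  qed
  have s0: "?s j = 0" if "j \<in> act - M" for j
  proof -
    have "{i. i < m \<and> run S i t = Some j} = {}" using that by (auto simp: M_def)
    then show ?thesis by (simp only: job_speed_def sum.empty)
  qed
  have "(\<Sum>j\<in>act. \<alpha> * \<sigma> j powr (\<alpha> - 1) * ?s j) = (\<Sum>j\<in>M. \<alpha> * \<sigma> j powr (\<alpha> - 1) * ?s j)"
    using s0 by (intro sum.mono_neutral_right act) (auto simp: M_def)
  also have "\<dots> \<le> (\<Sum>j\<in>M. ?s j powr \<alpha> + (\<alpha> - 1) * \<sigma> j powr \<alpha>)"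
    using Young_powr[OF \<alpha>] \<sigma> job_speed_nonneg[OF S t] by (intro sum_mono) (auto simp: M_def)
  also have "\<dots> = (\<Sum>j\<in>M. speed S (f j) t powr \<alpha>) + (\<alpha> - 1) * (\<Sum>j\<in>M. \<sigma> j powr \<alpha>)"
    using sM by (simp add: sum.distrib sum_distrib_left)
  also have "(\<Sum>j\<in>M. speed S (f j) t powr \<alpha>) = (\<Sum>i\<in>f ` M. speed S i t powr \<alpha>)"
    using inj by (simp add: sum.reindex)
  also have "\<dots> \<le> (\<Sum>i<m. speed S i t powr \<alpha>)" by (intro sum_mono2) (use f in auto)
  also have "(\<alpha> - 1) * (\<Sum>j\<in>M. \<sigma> j powr \<alpha>) \<le> C" by (rule C[OF _ cardM]) (auto simp: M_def)
  finally show ?thesis by simp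
qed

lemma sum_ennreal_indicator:
  assumes "finite A" "\<And>j. j \<in> A \<Longrightarrow> 0 \<le> f j"
  shows "(\<Sum>j\<in>A. ennreal (f j) * indicator (I j) t) = ennreal (\<Sum>j\<in>{j\<in>A. t \<in> I j}. f j)"
proof -
  have "(\<Sum>j\<in>A. ennreal (f j) * indicator (I j) t) = (\<Sum>j\<in>A. if t \<in> I j then ennreal (f j) else 0)"
    by (intro sum.cong) auto
  also have "\<dots> = (\<Sum>j\<in>{j\<in>A. t \<in> I j}. ennreal (f j))" by (rule sum.inter_filter[symmetric, OF assms(1)])
  also have "\<dots> = ennreal (\<Sum>j\<in>{j\<in>A. t \<in> I j}. f j)" using assms(2) by (intro sum_ennreal) auto
  finally show ?thesis .
qed

section \<open>Atomic intervals and the dual bound\<close>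

context pd_run begin

lemma time_points_set: "set (time_points J) = release ` set J \<union> deadline ` set J"
  by (simp add: time_points_def)

lemma ex_nth_time_point:
  assumes "t \<in> release ` set J \<union> deadline ` set J"
  shows "\<exists>a<length (time_points J). time_points J ! a = t"
  using assms unfolding time_points_set[symmetric] in_set_conv_nth .

lemma release_time_point: "j < length J \<Longrightarrow> \<exists>a<length (time_points J). time_points J ! a = release (J ! j)"
  by (intro ex_nth_time_point) simp

lemma deadline_time_point: "j < length J \<Longrightarrow> \<exists>a<length (time_points J). time_points J ! a = deadline (J ! j)"
  by (intro ex_nth_time_point) simp

lemma time_points_le_iff:
  "a < length (time_points J) \<Longrightarrow> b < length (time_points J) \<Longrightarrow>
    time_points J ! a \<le> time_points J ! b \<longleftrightarrow> a \<le> b"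
  using time_points_less[of a b] time_points_less[of b a] by (cases a b rule: linorder_cases) auto

text \<open>No release or deadline lies strictly inside an atomic interval, so availability can be
  tested at any one time of the half-open interval.\<close>

lemma available_iff:
  assumes k: "k < num_intervals J" and j: "j < length J"
    and t: "time_points J ! k \<le> t" "t < time_points J ! (k + 1)"
  shows "available J j k \<longleftrightarrow> release (J ! j) \<le> t \<and> t < deadline (J ! j)"
proof
  assume "release (J ! j) \<le> t \<and> t < deadline (J ! j)"
  moreover obtain a b where ab: "a < length (time_points J)" "time_points J ! a = release (J ! j)"
      "b < length (time_points J)" "time_points J ! b = deadline (J ! j)"
    using release_time_point[OF j] deadline_time_point[OF j] by blast
  moreover have k1: "k < length (time_points J)" "k + 1 < length (time_points J)"
    using k by (auto simp: num_intervals_def)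
  ultimately have "\<not> time_points J ! (k + 1) \<le> time_points J ! a" "\<not> time_points J ! b \<le> time_points J ! k"
    using t by auto
  then have "a \<le> k" "k + 1 \<le> b"
    using time_points_le_iff[of "k + 1" a] time_points_le_iff[of b k] ab(1,3) k1 by linarith+
  then show "available J j k"
    unfolding available_def ab(2,4)[symmetric] 
    using time_points_le_iff[of a k] time_points_le_iff[of "k + 1" b] ab(1,3) k1 by simp
qed (use t in \<open>auto simp: available_def\<close>)

lemma active_interval:
  assumes j: "j < length J" and t: "release (J ! j) \<le> t" "t < deadline (J ! j)"
  obtains k where "k < num_intervals J" "time_points J ! k \<le> t" "t < time_points J ! (k + 1)"
proof -
  obtain a b where ab: "a < length (time_points J)" "time_points J ! a = release (J ! j)"
      "b < length (time_points J)" "time_points J ! b = deadline (J ! j)"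
    using release_time_point[OF j] deadline_time_point[OF j] by blast
  define P where "P i \<longleftrightarrow> i < length (time_points J) \<and> t < time_points J ! i" for i
  have Pb: "P b" using ab t by (simp add: P_def)
  \<comment> \<open>The first time point after \<open>t\<close>. It is not index 0, since the
    release is at most \<open>t\<close>, so the interval ending there contains
    \<open>t\<close>.\<close>
  define i where "i = (LEAST i. P i)"
  have Pi: "P i" unfolding i_def by (rule LeastI[of P, OF Pb])
  have "time_points J ! 0 \<le> time_points J ! a" by (subst time_points_le_iff) (use ab(1) in auto)
  then have "\<not> P 0" using ab(2) t by (auto simp: P_def)
  then obtain k where k: "i = Suc k" using Pi by (cases i) auto
  have "\<not> P k" using not_less_Least[of k P] k by (simp add: i_def)
  then have "time_points J ! k \<le> t" using Pi k by (auto simp: P_def)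
  then show thesis using that[of k] Pi k by (auto simp: P_def num_intervals_def)
qed

text \<open>Weak duality: a finished job pays its price \<open>\<lambda>\<close> through the work processed for it and a
  rejected one through its value; Young's inequality bounds the price of the work at each time by the
  power spent plus the conjugate term \<open>C\<close>.\<close>

lemma schedule_cost_dual_bound:
  assumes S: "valid_schedule m J S"
    and \<sigma>: "\<And>j. j < length J \<Longrightarrow> 0 \<le> \<sigma> j"
    and le: "\<And>j. j < length J \<Longrightarrow> \<alpha> * workload (J ! j) * \<sigma> j powr (\<alpha> - 1) \<le> worth (J ! j)"
    and C: "\<And>k M. k < num_intervals J \<Longrightarrow> M \<subseteq> {j. j < length J \<and> available J j k} \<Longrightarrow> card M \<le> m \<Longrightarrow>
      (\<alpha> - 1) * (\<Sum>j\<in>M. \<sigma> j powr \<alpha>) \<le> C k"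
  shows "ennreal (\<Sum>j<length J. \<alpha> * workload (J ! j) * \<sigma> j powr (\<alpha> - 1))
    \<le> schedule_cost \<alpha> m J S + ennreal (\<Sum>k<num_intervals J. interval_length J k * C k)"
proof -
  let ?n = "length J" and ?K = "num_intervals J"
  define I where "I j = {release (J ! j)..<deadline (J ! j)}" for j
  define T where "T k = {time_points J ! k..<time_points J ! (k + 1)}" for k
  define \<pi> where "\<pi> j = \<alpha> * \<sigma> j powr (\<alpha> - 1)" for j
  define s where "s j = job_speed m S j" for j
  have \<pi>0: "0 \<le> \<pi> j" for j using \<alpha> by (simp add: \<pi>_def)
  have sm[measurable]: "s j \<in> borel_measurable borel" for j
    unfolding s_def by (rule job_speed_measurable[OF S])
  have Im[measurable]: "I j \<in> sets borel" for j by (simp add: I_def)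
  have Tm[measurable]: "T k \<in> sets borel" for k by (simp add: T_def)
  have Pm: "speed S i \<in> borel_measurable borel" if "i < m" for i
    using S that by (auto simp: valid_schedule_def)
  have C0: "0 \<le> C k" if "k < ?K" for k using C[OF that, of "{}"] by simp
  \<comment> \<open>\<open>G\<close> is the price collected at time \<open>t\<close> for work on
    active jobs, \<open>H\<close> the power spent plus the conjugate term of the interval containing
    \<open>t\<close>.\<close>
  define G where "G t = (\<Sum>j<?n. ennreal (\<pi> j) * ennreal (s j t) * indicator (I j) t)" for t
  define H where "H t = (\<Sum>i<m. ennreal (speed S i t powr \<alpha>) * indicator {0..} t) +
    (\<Sum>k<?K. ennreal (C k) * indicator (T k) t)" for t
  have GH: "G t \<le> H t" for t
  proof -
    define act where "act = {j \<in> {..<?n}. t \<in> I j}"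
    show ?thesis
    proof (cases "act = {}")
      case True
      then have "G t = 0" unfolding G_def by (intro sum.neutral) (auto simp: act_def)
      then show ?thesis by simp
    next
      case False
      then obtain j where j: "j < ?n" "t \<in> I j" by (auto simp: act_def)
      then have t0: "0 \<le> t" using release_nonneg by (auto simp: I_def intro: order_trans)
      obtain k where k: "k < ?K" "t \<in> T k"
        using active_interval[of j t] j by (auto simp: I_def T_def)
      have act: "act = {j. j < ?n \<and> available J j k}"
        using available_iff[OF k(1)] k(2) by (auto simp: act_def T_def I_def)
      have s0: "0 \<le> s j t" for j unfolding s_def by (rule job_speed_nonneg[OF S t0])
      have "G t = (\<Sum>j<?n. ennreal (\<pi> j * s j t) * indicator (I j) t)"
        unfolding G_def using \<pi>0 s0 by (simp add: ennreal_mult)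
      also have "\<dots> = ennreal (\<Sum>j\<in>act. \<pi> j * s j t)"
        unfolding act_def using \<pi>0 s0 by (intro sum_ennreal_indicator) auto
      also have "(\<Sum>j\<in>act. \<pi> j * s j t) \<le> (\<Sum>i<m. speed S i t powr \<alpha>) + C k"
        unfolding \<pi>_def s_def
        by (rule job_speeds_pointwise[OF S t0 \<alpha>]) (use \<sigma> C[OF k(1)] act in auto)
      finally have "G t \<le> ennreal ((\<Sum>i<m. speed S i t powr \<alpha>) + C k)" by (simp add: ennreal_leI)
      also have "\<dots> = ennreal (\<Sum>i<m. speed S i t powr \<alpha>) + ennreal (C k)"
        using C0[OF k(1)] by (intro ennreal_plus) (auto intro: sum_nonneg)
      also have "ennreal (\<Sum>i<m. speed S i t powr \<alpha>) = (\<Sum>i<m. ennreal (speed S i t powr \<alpha>) * indicator {0..} t)"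
        using t0 by (simp add: sum_ennreal)
      also have "ennreal (C k) = (\<Sum>k\<in>{k}. ennreal (C k) * indicator (T k) t)"
        using k by simp
      also have "\<dots> \<le> (\<Sum>k<?K. ennreal (C k) * indicator (T k) t)"
        using k by (intro sum_mono2) auto
      finally show ?thesis unfolding H_def by (simp add: add_left_mono)
    qed
  qed
  \<comment> \<open>The model uses closed windows, whereas \<open>I j\<close> is half-open to match
    the atomic intervals; they differ in the deadline, a null set.\<close>
  have intI: "(\<integral>\<^sup>+t\<in>{release (J ! j)..deadline (J ! j)}. ennreal (job_speed m S j t) \<partial>lborel) =
      (\<integral>\<^sup>+t. ennreal (s j t) * indicator (I j) t \<partial>lborel)" for j
  proof (rule nn_integral_cong_AE)
    have "AE t in lborel. t \<noteq> deadline (J ! j)" by (rule AE_lborel_singleton)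
    then show "AE t in lborel. ennreal (job_speed m S j t) * indicator {release (J ! j)..deadline (J ! j)} t =
        ennreal (s j t) * indicator (I j) t"
      by eventually_elim (auto simp: I_def s_def indicator_def)
  qed
  have job: "ennreal (\<alpha> * workload (J ! j) * \<sigma> j powr (\<alpha> - 1)) \<le>
      (if j \<in> rejected m J S then ennreal (worth (J ! j)) else 0) +
      (\<integral>\<^sup>+t. ennreal (\<pi> j) * ennreal (s j t) * indicator (I j) t \<partial>lborel)"
    if j: "j < ?n" for j
  proof (cases "j \<in> rejected m J S")
    case True
    have "ennreal (\<alpha> * workload (J ! j) * \<sigma> j powr (\<alpha> - 1)) \<le> ennreal (worth (J ! j))"
      using le[OF j] by (rule ennreal_leI)
    then show ?thesis using True by (simp add: add_increasing2)
  next
    case False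
    then have "finished m J S j" using j by (simp add: rejected_def)
    then have "ennreal (workload (J ! j)) \<le> (\<integral>\<^sup>+t. ennreal (s j t) * indicator (I j) t \<partial>lborel)"
      unfolding finished_def intI .
    then have "ennreal (\<pi> j) * ennreal (workload (J ! j)) \<le>
        ennreal (\<pi> j) * (\<integral>\<^sup>+t. ennreal (s j t) * indicator (I j) t \<partial>lborel)"
      by (rule mult_left_mono) simp
    also have "\<dots> = (\<integral>\<^sup>+t. ennreal (\<pi> j) * (ennreal (s j t) * indicator (I j) t) \<partial>lborel)"
      by (rule nn_integral_cmult[symmetric]) measurable
    also have "ennreal (\<pi> j) * ennreal (workload (J ! j)) = ennreal (\<alpha> * workload (J ! j) * \<sigma> j powr (\<alpha> - 1))"
      using \<pi>0[of j] workload_pos j by (subst ennreal_mult[symmetric]) (simp_all add: \<pi>_def mult_ac less_imp_le)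
    finally show ?thesis using False by (simp add: mult.assoc)
  qed
  have "ennreal (\<Sum>j<?n. \<alpha> * workload (J ! j) * \<sigma> j powr (\<alpha> - 1)) =
      (\<Sum>j<?n. ennreal (\<alpha> * workload (J ! j) * \<sigma> j powr (\<alpha> - 1)))"
    using \<alpha> workload_pos by (intro sum_ennreal[symmetric]) (simp add: less_imp_le)
  also have "\<dots> \<le> (\<Sum>j<?n. (if j \<in> rejected m J S then ennreal (worth (J ! j)) else 0) +
      (\<integral>\<^sup>+t. ennreal (\<pi> j) * ennreal (s j t) * indicator (I j) t \<partial>lborel))"
    using job by (intro sum_mono) auto
  also have "\<dots> = (\<Sum>j<?n. if j \<in> rejected m J S then ennreal (worth (J ! j)) else 0) + (\<integral>\<^sup>+t. G t \<partial>lborel)"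
  proof -
    have "(\<integral>\<^sup>+t. G t \<partial>lborel) =
        (\<Sum>j<?n. \<integral>\<^sup>+t. ennreal (\<pi> j) * ennreal (s j t) * indicator (I j) t \<partial>lborel)"
      unfolding G_def by (rule nn_integral_sum) measurable
    then show ?thesis by (simp only: sum.distrib)
  qed
  also have "(\<Sum>j<?n. if j \<in> rejected m J S then ennreal (worth (J ! j)) else 0) =
      (\<Sum>j\<in>{j\<in>{..<?n}. j \<in> rejected m J S}. ennreal (worth (J ! j)))"
    by (rule sum.inter_filter[symmetric]) simp
  also have "\<dots> = ennreal (\<Sum>j\<in>{j\<in>{..<?n}. j \<in> rejected m J S}. worth (J ! j))"
    using worth_pos by (intro sum_ennreal) (simp add: less_imp_le)
  also have "{j\<in>{..<?n}. j \<in> rejected m J S} = rejected m J S" by (auto simp: rejected_def)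
  also have "(\<integral>\<^sup>+t. G t \<partial>lborel) \<le> (\<integral>\<^sup>+t. H t \<partial>lborel)" using GH by (intro nn_integral_mono) auto
  also have "(\<integral>\<^sup>+t. H t \<partial>lborel) =
      (\<Sum>i<m. \<integral>\<^sup>+t\<in>{0..}. ennreal (speed S i t powr \<alpha>) \<partial>lborel) +
      (\<Sum>k<?K. \<integral>\<^sup>+t. ennreal (C k) * indicator (T k) t \<partial>lborel)"
  proof -
    have 1: "(\<lambda>t. ennreal (speed S i t powr \<alpha>) * indicator {0..} t) \<in> borel_measurable lborel"
      if "i \<in> {..<m}" for i
      using Pm that by simp
    have 2: "(\<lambda>t. ennreal (C k) * indicator (T k) t) \<in> borel_measurable lborel" for k
      by measurable
    have "(\<integral>\<^sup>+t. H t \<partial>lborel) =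
        (\<integral>\<^sup>+t. (\<Sum>i<m. ennreal (speed S i t powr \<alpha>) * indicator {0..} t) \<partial>lborel) +
        (\<integral>\<^sup>+t. (\<Sum>k<?K. ennreal (C k) * indicator (T k) t) \<partial>lborel)"
      unfolding H_def by (rule nn_integral_add) (use 1 2 in \<open>intro borel_measurable_sum; blast\<close>)+
    also have "(\<integral>\<^sup>+t. (\<Sum>i<m. ennreal (speed S i t powr \<alpha>) * indicator {0..} t) \<partial>lborel) =
        (\<Sum>i<m. \<integral>\<^sup>+t\<in>{0..}. ennreal (speed S i t powr \<alpha>) \<partial>lborel)"
      by (rule nn_integral_sum) (rule 1)
    also have "(\<integral>\<^sup>+t. (\<Sum>k<?K. ennreal (C k) * indicator (T k) t) \<partial>lborel) =
        (\<Sum>k<?K. \<integral>\<^sup>+t. ennreal (C k) * indicator (T k) t \<partial>lborel)"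
      by (rule nn_integral_sum) (rule 2)
    finally show ?thesis .
  qed
  also have "(\<Sum>k<?K. \<integral>\<^sup>+t. ennreal (C k) * indicator (T k) t \<partial>lborel) =
      (\<Sum>k<?K. ennreal (interval_length J k * C k))"
  proof (rule sum.cong[OF refl])
    fix k assume "k \<in> {..<?K}"
    then have k: "k < ?K" by simp
    have "emeasure lborel (T k) = ennreal (interval_length J k)"
      using interval_length_pos[OF k] by (simp add: T_def interval_length_def)
    then show "(\<integral>\<^sup>+t. ennreal (C k) * indicator (T k) t \<partial>lborel) = ennreal (interval_length J k * C k)"
      using C0[OF k] interval_length_pos[OF k]
      by (simp add: nn_integral_cmult_indicator ennreal_mult mult.commute)
  qed
  also have "\<dots> = ennreal (\<Sum>k<?K. interval_length J k * C k)"
    using C0 interval_length_pos by (intro sum_ennreal) (simp add: less_imp_le)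
  finally show ?thesis unfolding schedule_cost_def by (simp add: add_ac)
qed

end

section \<open>Upper bound\<close>

context pd_run begin

abbreviation "state \<equiv> pd_assignment \<alpha> m \<delta> J"
abbreviation "final \<equiv> state (length J)"

lemma state_later: "i \<ge> j \<Longrightarrow> state j i k = 0"
  by (induction j) auto

lemma state_earlier: "i < j \<Longrightarrow> state j i k = pd_portions \<alpha> m \<delta> J (state i) i k"
  by (induction j) (auto simp: less_Suc_eq)

lemma assignment_state: "j \<le> length J \<Longrightarrow> assignment (state j)"
proof (induction j)
  case (Suc j)
  then show ?case
    using pd_portions_nonneg[of "state j" j] by (auto simp: assignment_def)
qed (simp add: assignment_def)

lemma state_mono: "j \<le> length J \<Longrightarrow> k < num_intervals J \<Longrightarrow> i < length J \<Longrightarrow> state j i k \<le> final i k"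
  using assignment_state[of "length J"] state_earlier[of i j] state_earlier[of i "length J"]
    state_later[of j i k]
  by (cases "i < j") (auto simp: assignment_def)

definition dual_price :: "nat \<Rightarrow> real" where
  "dual_price j = price (state j) j"

text \<open>The portion at which the marginal cost of job \<open>j\<close> reaches its price; it is assigned
  only if \<open>j\<close> is accepted.\<close>

definition planned :: "nat \<Rightarrow> nat \<Rightarrow> real" where
  "planned j k = level (state j) j k (dual_price j)"

text \<open>The speed at which the marginal cost of job \<open>j\<close> equals its price, hence the
  same in all intervals with a positive planned portion.\<close>

definition planned_speed :: "nat \<Rightarrow> real" where
  "planned_speed j = (dual_price j / (\<delta> * (\<alpha> * workload (J ! j)))) powr (1 / (\<alpha> - 1))"

abbreviation "accepted j \<equiv> accepts (state j) j"

lemma final_eq: "j < length J \<Longrightarrow> final j k = (if accepted j then planned j k else 0)"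
  by (simp add: state_earlier pd_portions_def planned_def dual_price_def)

context
  fixes j assumes j: "j < length J"
begin

lemma assignment_state_j: "assignment (state j)"
  using j by (intro assignment_state) simp

lemma dual_price_bounds: "0 \<le> dual_price j" "dual_price j \<le> worth (J ! j)"
  unfolding dual_price_def using price_bounds[OF assignment_state_j j] by auto

lemma dual_price_rejected: "\<not> accepted j \<Longrightarrow> dual_price j = worth (J ! j)"
  by (simp add: dual_price_def pd_price_def)

lemma planned_nonneg: "k < num_intervals J \<Longrightarrow> 0 \<le> planned j k"
  unfolding planned_def by (rule pd_level_nonneg[OF assignment_state_j j])

lemma sum_planned_accepted: "accepted j \<Longrightarrow> (\<Sum>k<num_intervals J. planned j k) = 1"
  using price_accepted(3)[OF assignment_state_j j]
  by (simp add: planned_def pd_total_def dual_price_def)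

lemma sum_planned_rejected: "\<not> accepted j \<Longrightarrow> (\<Sum>k<num_intervals J. planned j k) \<le> 1"
  by (simp add: pd_accepts_def planned_def pd_total_def dual_price_rejected)

lemma planned_speed_nonneg: "0 \<le> planned_speed j"
  by (simp add: planned_speed_def)

lemma dual_price_eq: "dual_price j = \<delta> * (\<alpha> * workload (J ! j) * planned_speed j powr (\<alpha> - 1))"
proof -
  have c: "\<delta> * (\<alpha> * workload (J ! j)) > 0" using \<alpha> \<delta> workload_pos j by simp
  have "planned_speed j powr (\<alpha> - 1) = dual_price j / (\<delta> * (\<alpha> * workload (J ! j)))"
    using \<alpha> c dual_price_bounds by (simp add: planned_speed_def powr_powr)
  then have "\<delta> * (\<alpha> * workload (J ! j)) * planned_speed j powr (\<alpha> - 1) = dual_price j"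
    using c by (simp only: nonzero_mult_div_cancel_left times_divide_eq_right)
  then show ?thesis by (simp add: mult.assoc)
qed

context
  fixes k assumes k: "k < num_intervals J"
begin

text \<open>An interval is skipped if its marginal cost at portion 0 is at the price or higher; the
  speed there may exceed the planned one.\<close>

lemma planned_speed_le:
  assumes av: "available J j k"
  shows "planned_speed j \<le> speed_at (state j) j k (planned j k)"
proof (rule ccontr)
  assume "\<not> ?thesis"
  then have "speed_at (state j) j k (planned j k) powr (\<alpha> - 1) < planned_speed j powr (\<alpha> - 1)"
    using \<alpha> speed_at_nonneg[OF assignment_state_j j k planned_nonneg[OF k]]
    by (intro powr_less_mono2) auto
  moreover have "0 < \<delta> * (\<alpha> * workload (J ! j))" using \<alpha> \<delta> workload_pos j by simp
  ultimately have "marginal (state j) j k (planned j k) < dual_price j"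
    unfolding marginal_eq[OF assignment_state_j j k planned_nonneg[OF k]] dual_price_eq
    using \<alpha> \<delta> workload_pos j by simp
  then show False
    using marginal_pd_level[OF assignment_state_j j k av, of "dual_price j"] by (simp add: planned_def)
qed

lemma planned_speed_eq:
  assumes "0 < planned j k"
  shows "planned_speed j = speed_at (state j) j k (planned j k)"
proof -
  have "marginal (state j) j k (planned j k) = dual_price j"
    using marginal_pd_level_pos[OF assignment_state_j j k] assms by (simp add: planned_def)
  moreover have "0 < workload (J ! j)" using workload_pos j by simp
  ultimately have "speed_at (state j) j k (planned j k) powr (\<alpha> - 1) = planned_speed j powr (\<alpha> - 1)"
    unfolding marginal_eq[OF assignment_state_j j k planned_nonneg[OF k]] dual_price_eq
    using \<alpha> \<delta> by simp
  then show ?thesis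
    using \<alpha> planned_speed_nonneg speed_at_nonneg[OF assignment_state_j j k planned_nonneg[OF k]]
      powr_less_mono2[of "\<alpha> - 1" "planned_speed j" "speed_at (state j) j k (planned j k)"]
      powr_less_mono2[of "\<alpha> - 1" "speed_at (state j) j k (planned j k)" "planned_speed j"]
    by (cases "planned_speed j" "speed_at (state j) j k (planned j k)" rule: linorder_cases) auto
qed

text \<open>By convexity, the tangent at the new portion, evaluated back at portion 0, bounds the
  increase by portion times final marginal energy. Where the portion is positive, that marginal
  energy is the price over \<open>\<delta>\<close>.\<close>

lemma energy_increase:
  "interval_energy \<alpha> m J k (\<lambda>i. state (Suc j) i k) - interval_energy \<alpha> m J k (\<lambda>i. state j i k)
    \<le> (if accepted j then planned j k * dual_price j / \<delta> else 0)"
proof (cases "accepted j")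
  case True
  let ?x = "\<lambda>i. state j i k" and ?z = "planned j k"
  have x0: "(\<lambda>i. state j i k) = ?x(j := 0)" using state_later[of j j k] by auto
  have xz: "(\<lambda>i. state (Suc j) i k) = ?x(j := ?z)"
    using True by (auto simp: pd_portions_def planned_def dual_price_def)
  have "interval_energy \<alpha> m J k (?x(j := ?z)) + \<alpha> * workload (J ! j) *
      speed_at (state j) j k ?z powr (\<alpha> - 1) * (0 - ?z) \<le> interval_energy \<alpha> m J k (?x(j := 0))"
    by (rule interval_energy_update_subgradient[OF m \<alpha> j _ workload_pos interval_length_pos[OF k]])
      (use assignment_state_j k planned_nonneg[OF k] in \<open>auto simp: assignment_def\<close>)
  moreover have "\<alpha> * workload (J ! j) * speed_at (state j) j k ?z powr (\<alpha> - 1) * ?z = ?z * dual_price j / \<delta>"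
  proof (cases "?z = 0")
    case False
    then have "planned_speed j = speed_at (state j) j k ?z"
      using planned_nonneg[OF k] by (intro planned_speed_eq) simp
    then show ?thesis unfolding dual_price_eq using \<delta> by simp
  qed simp
  ultimately show ?thesis using True unfolding xz by (subst (2) x0) simp
next
  case False
  have "(\<lambda>i. state (Suc j) i k) = (\<lambda>i. state j i k)"
    using False state_later[of j j k] by (auto simp: pd_portions_def)
  then show ?thesis using False by simp
qed

text \<open>An accepted job keeps its portion, and later loads only raise speeds. For a rejected
  job, leaving its planned load out lowers the speed by at most that load, by
  \<open>pool_level_update_lipschitz\<close>.\<close>

lemma planned_speed_le_final:
  assumes av: "available J j k"
  shows "planned_speed j \<le> chen_speed m jobs (unit_load J k (\<lambda>i. final i k)) j +
    (if accepted j then 0 else planned j k * (workload (J ! j) / interval_length J k))"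
proof -
  let ?a = "unit_load J k (\<lambda>i. final i k)" and ?b = "unit_load J k (\<lambda>i. state j i k)"
  define u where "u = planned j k * (workload (J ! j) / interval_length J k)"
  have l: "0 < interval_length J k" by (rule interval_length_pos[OF k])
  have u0: "0 \<le> u" using planned_nonneg[OF k] workload_pos j l by (simp add: u_def less_imp_le)
  have b0: "\<forall>i\<in>jobs. 0 \<le> ?b i" by (rule base_load_nonneg[OF assignment_state_j k])
  have ba: "\<forall>i\<in>jobs. ?b i \<le> ?a i"
    using state_mono[of j k] j k workload_pos l
    by (auto simp: unit_load_def load_def less_imp_le intro!: divide_right_mono mult_right_mono)
  have bu: "speed_at (state j) j k (planned j k) = chen_speed m jobs (?b(j := u)) j"
    by (simp add: unit_load_update u_def)
  note le = planned_speed_le[OF av, unfolded bu]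
  show ?thesis
  proof (cases "accepted j")
    case True
    have aj: "?a j = u" using True final_eq[OF j, of k] by (simp add: unit_load_def load_def u_def)
    have "chen_speed m jobs (?b(j := u)) j \<le> chen_speed m jobs ?a j"
      by (rule chen_speed_mono[OF _ m]) (use b0 u0 ba aj j in auto)
    then show ?thesis using True le by simp
  next
    case False
    have bj: "?b(j := 0) = ?b" using state_later[of j j k] by (auto simp: unit_load_def load_def)
    have "pool_level m jobs (?b(j := 0 + u)) \<le> pool_level m jobs (?b(j := 0)) + u"
      by (rule pool_level_update_lipschitz[OF _ m b0]) (use j u0 in auto)
    moreover have "pool_level m jobs ?b \<le> pool_level m jobs ?a"
      by (rule pool_level_mono[OF _ m b0 ba]) simp
    ultimately have "pool_level m jobs (?b(j := u)) \<le> pool_level m jobs ?a + u"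
      unfolding bj add_0_left by linarith
    moreover have "0 \<le> pool_level m jobs ?a"
      by (rule pool_level_nonneg[OF _ m base_load_nonneg[OF assignment_state[OF order_refl] k]]) simp
    ultimately have "chen_speed m jobs (?b(j := u)) j \<le> chen_speed m jobs ?a j + u"
      unfolding chen_speed_def fun_upd_same by linarith
    then show ?thesis using False le by (simp add: u_def)
  qed
qed

end

end

text \<open>\<open>energy_increase\<close> telescopes over the jobs, starting from energy 0 of the
  empty assignment.\<close>

lemma final_energy_le:
  assumes k: "k < num_intervals J"
  shows "interval_energy \<alpha> m J k (\<lambda>i. final i k) \<le>
    (\<Sum>j | j < length J \<and> accepted j. planned j k * dual_price j / \<delta>)"
proof -
  have "interval_energy \<alpha> m J k (\<lambda>i. state j i k) \<le>
    (\<Sum>i\<in>{i\<in>{..<j}. accepted i}. planned i k * dual_price i / \<delta>)" if "j \<le> length J" for j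
    using that
  proof (induction j)
    case 0
    have "interval_energy \<alpha> m J k (\<lambda>i. 0) = 0"
      by (simp add: interval_energy_def Let_def load_def dedicated_def)
    then show ?case by simp
  next
    case (Suc j)
    have "(\<Sum>i\<in>{i\<in>{..<Suc j}. accepted i}. planned i k * dual_price i / \<delta>) =
      (\<Sum>i\<in>{i\<in>{..<j}. accepted i}. planned i k * dual_price i / \<delta>) +
      (if accepted j then planned j k * dual_price j / \<delta> else 0)"
      by (simp only: sum.inter_filter finite_lessThan sum.lessThan_Suc)
    then show ?case using Suc energy_increase[of j k] k by simp
  qed
  from this[of "length J"] show ?thesis by simp
qed

text \<open>The tangent at the planned speed bounds its power by that of the final speed plus a
  correction for the excess \<open>u\<close>. The energy controls the final speeds, since the 0-1
  weights of \<open>M\<close> are admissible; times the interval length, the correction is planned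
  portion times price over \<open>\<delta>\<close>.\<close>

lemma planned_speeds_le_energy:
  assumes k: "k < num_intervals J" and M: "M \<subseteq> {j. j < length J \<and> available J j k}" "card M \<le> m"
  shows "interval_length J k * (\<Sum>j\<in>M. planned_speed j powr \<alpha>) \<le>
    interval_energy \<alpha> m J k (\<lambda>i. final i k) +
    (\<Sum>j | j < length J \<and> \<not> accepted j. planned j k * dual_price j / \<delta>)"
proof -
  let ?a = "unit_load J k (\<lambda>i. final i k)" and ?l = "interval_length J k"
  let ?s = "chen_speed m jobs ?a"
  define u where "u j = (if accepted j then 0 else planned j k * (workload (J ! j) / ?l))" for j
  have l: "0 < ?l" by (rule interval_length_pos[OF k])
  have a0: "\<forall>i\<in>jobs. 0 \<le> ?a i"
    by (rule base_load_nonneg[OF assignment_state[OF order_refl] k])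
  have M': "M \<subseteq> jobs" "finite M" using M(1) by (auto intro: finite_subset[of M jobs])
  have one: "planned_speed j powr \<alpha> \<le> ?s j powr \<alpha> + \<alpha> * u j * planned_speed j powr (\<alpha> - 1)"
    if "j \<in> M" for j
  proof -
    let ?p = "planned_speed j"
    have j: "j < length J" "available J j k" using M(1) that by auto
    have p0: "0 \<le> ?p" by (rule planned_speed_nonneg[OF j(1)])
    have s0: "0 \<le> ?s j" by (rule chen_speed_nonneg[OF _ m a0]) simp
    have "?p powr (\<alpha> - 1) * (?p - ?s j) \<le> ?p powr (\<alpha> - 1) * u j"
      using planned_speed_le_final[OF j(1) k j(2)] by (intro mult_left_mono) (auto simp: u_def)
    then have "\<alpha> * (?p powr (\<alpha> - 1) * ?p) - \<alpha> * ?p powr (\<alpha> - 1) * ?s j \<le> \<alpha> * u j * ?p powr (\<alpha> - 1)"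
      using \<alpha> mult_left_mono[of "?p powr (\<alpha> - 1) * (?p - ?s j)" "?p powr (\<alpha> - 1) * u j" \<alpha>]
      by (simp add: algebra_simps)
    then show ?thesis
      using Young_powr[OF \<alpha> p0 s0] powr_diff_one_mult[OF p0, of \<alpha>] by (simp add: algebra_simps)
  qed
  have "(\<Sum>j\<in>M. planned_speed j powr \<alpha>) \<le>
      (\<Sum>j\<in>M. ?s j powr \<alpha>) + (\<Sum>j\<in>M. \<alpha> * u j * planned_speed j powr (\<alpha> - 1))"
    unfolding sum.distrib[symmetric] by (rule sum_mono) (rule one)
  also have "(\<Sum>j\<in>M. ?s j powr \<alpha>) = (\<Sum>j\<in>{j\<in>jobs. j \<in> M}. ?s j powr \<alpha>)"
    using M' by (intro sum.cong) auto
  also have "\<dots> = (\<Sum>j\<in>jobs. if j \<in> M then ?s j powr \<alpha> else 0)"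
    by (rule sum.inter_filter) simp
  also have "\<dots> = (\<Sum>j\<in>jobs. of_bool (j \<in> M) * ?s j powr \<alpha>)"
    by (intro sum.cong) auto
  also have "\<dots> \<le> chen_energy \<alpha> m jobs ?a"
  proof (rule weighted_speeds_le_chen_energy[OF _ m a0 \<alpha>])
    have "(\<Sum>j\<in>jobs. of_bool (j \<in> M) :: real) = card (jobs \<inter> M)"
      by (simp add: of_bool_def sum.If_cases Int_def)
    also have "jobs \<inter> M = M" using M' by auto
    finally show "(\<Sum>j\<in>jobs. of_bool (j \<in> M)) \<le> real m" using M(2) by simp
  qed auto
  finally have "?l * (\<Sum>j\<in>M. planned_speed j powr \<alpha>) \<le>
      ?l * chen_energy \<alpha> m jobs ?a + ?l * (\<Sum>j\<in>M. \<alpha> * u j * planned_speed j powr (\<alpha> - 1))"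
    using l by (simp flip: distrib_left)
  also have "?l * chen_energy \<alpha> m jobs ?a = interval_energy \<alpha> m J k (\<lambda>i. final i k)"
    by (rule interval_energy_eq[symmetric, OF m _ workload_pos l])
      (use assignment_state[of "length J"] k in \<open>auto simp: assignment_def\<close>)
  also have "?l * (\<Sum>j\<in>M. \<alpha> * u j * planned_speed j powr (\<alpha> - 1)) =
      (\<Sum>j\<in>M. if accepted j then 0 else planned j k * dual_price j / \<delta>)"
    unfolding sum_distrib_left
  proof (rule sum.cong[OF refl])
    fix j assume "j \<in> M"
    then have "j < length J" using M' by auto
    then show "?l * (\<alpha> * u j * planned_speed j powr (\<alpha> - 1)) =
        (if accepted j then 0 else planned j k * dual_price j / \<delta>)"
      using l \<delta> by (simp add: dual_price_eq u_def)
  qed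
  also have "\<dots> \<le> (\<Sum>j\<in>jobs. if accepted j then 0 else planned j k * dual_price j / \<delta>)"
    using M' planned_nonneg k dual_price_bounds \<delta> by (intro sum_mono2) auto
  also have "\<dots> = (\<Sum>j\<in>jobs. if \<not> accepted j then planned j k * dual_price j / \<delta> else 0)"
    by (intro sum.cong) auto
  also have "\<dots> = (\<Sum>j\<in>{j\<in>jobs. \<not> accepted j}. planned j k * dual_price j / \<delta>)"
    by (rule sum.inter_filter[symmetric]) simp
  finally show ?thesis by simp
qed

section \<open>Combining the energy estimates with weak duality\<close>

lemma pd_cost_le:
  assumes \<delta>_eq: "\<delta> = 1 / \<alpha> powr (\<alpha> - 1)" and S: "valid_schedule m J S"
  shows "ennreal (pd_cost \<alpha> m \<delta> J) \<le> ennreal (\<alpha> powr \<alpha>) * schedule_cost \<alpha> m J S"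
proof -
  let ?K = "num_intervals J" and ?n = "length J"
  define E where "E k = interval_energy \<alpha> m J k (\<lambda>i. final i k)" for k
  define R where "R = {j. j < ?n \<and> \<not> accepted j}"
  define Ac where "Ac = {j. j < ?n \<and> accepted j}"
  \<comment> \<open>Division by \<open>\<alpha>\<close> with this choice of \<open>\<delta>\<close>
    turns the price into \<open>\<alpha> w \<sigma> powr (\<alpha> - 1)\<close>, the form required
    by weak duality.\<close>
  define \<sigma> where "\<sigma> j = planned_speed j / \<alpha>" for j
  \<comment> \<open>\<open>B k\<close> bounds the sum of
    \<open>planned_speed j powr \<alpha>\<close> over any at most \<open>m\<close> jobs available in
    interval \<open>k\<close>; \<open>C k\<close> is the conjugate bound after rescaling speeds by
    \<open>1 / \<alpha>\<close>.\<close>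
  define B where "B k = (E k + (\<Sum>j\<in>R. planned j k * dual_price j / \<delta>)) / interval_length J k" for k
  define C where "C k = (\<alpha> - 1) / \<alpha> powr \<alpha> * B k" for k
  have \<alpha>0: "\<alpha> > 0" using \<alpha> by simp
  have pa: "\<alpha> powr \<alpha> > 0" using \<alpha>0 by simp
  have pw: "\<alpha> powr (\<alpha> - 1) = 1 / \<delta>" using \<delta>_eq by simp
  have \<alpha>\<delta>: "\<alpha> powr \<alpha> * \<delta> = \<alpha>" using \<alpha>0 by (simp add: \<delta>_eq powr_diff)
  have fin: "finite R" "finite Ac" by (simp_all add: R_def Ac_def)
  have split: "sum f jobs = sum f Ac + sum f R" for f :: "nat \<Rightarrow> real"
  proof -
    have "jobs = Ac \<union> R" "Ac \<inter> R = {}" by (auto simp: Ac_def R_def)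
    then show ?thesis using fin by (simp add: sum.union_disjoint)
  qed
  have \<sigma>price: "\<alpha> * workload (J ! j) * \<sigma> j powr (\<alpha> - 1) = dual_price j" if "j < ?n" for j
    using \<alpha>0 planned_speed_nonneg[OF that]
    by (simp add: dual_price_eq[OF that] \<sigma>_def powr_divide pw)
  have "ennreal (\<Sum>j<?n. \<alpha> * workload (J ! j) * \<sigma> j powr (\<alpha> - 1))
    \<le> schedule_cost \<alpha> m J S + ennreal (\<Sum>k<?K. interval_length J k * C k)"
  proof (rule schedule_cost_dual_bound[OF S])
    show "0 \<le> \<sigma> j" if "j < ?n" for j using \<alpha>0 planned_speed_nonneg[OF that] by (simp add: \<sigma>_def)
    show "\<alpha> * workload (J ! j) * \<sigma> j powr (\<alpha> - 1) \<le> worth (J ! j)" if "j < ?n" for j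
      using \<sigma>price dual_price_bounds that by simp
    fix k M assume k: "k < ?K" and M: "M \<subseteq> {j. j < ?n \<and> available J j k}" "card M \<le> m"
    have "(\<Sum>j\<in>M. \<sigma> j powr \<alpha>) = (\<Sum>j\<in>M. planned_speed j powr \<alpha>) / \<alpha> powr \<alpha>"
      unfolding sum_divide_distrib using M(1) \<alpha>0 planned_speed_nonneg
      by (intro sum.cong) (auto simp: \<sigma>_def powr_divide)
    also have "(\<Sum>j\<in>M. planned_speed j powr \<alpha>) \<le> B k"
      using planned_speeds_le_energy[OF k M] interval_length_pos[OF k]
      by (simp add: B_def E_def R_def le_divide_eq mult.commute)
    finally have "(\<Sum>j\<in>M. \<sigma> j powr \<alpha>) \<le> B k / \<alpha> powr \<alpha>" by (simp add: divide_right_mono)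
    then show "(\<alpha> - 1) * (\<Sum>j\<in>M. \<sigma> j powr \<alpha>) \<le> C k"
      using mult_left_mono[of "\<Sum>j\<in>M. \<sigma> j powr \<alpha>" "B k / \<alpha> powr \<alpha>" "\<alpha> - 1"] \<alpha> by (simp add: C_def)
  qed
  also have "(\<Sum>j<?n. \<alpha> * workload (J ! j) * \<sigma> j powr (\<alpha> - 1)) = sum dual_price jobs"
    using \<sigma>price by (intro sum.cong) auto
  finally have dual: "ennreal (sum dual_price jobs)
    \<le> schedule_cost \<alpha> m J S + ennreal (\<Sum>k<?K. interval_length J k * C k)" .
  \<comment> \<open>The portions of an accepted job sum to 1, so its total charge is its price over
    \<open>\<delta>\<close>; in \<open>lC\<close>, those planned for a rejected job sum to at most
    1.\<close>
  have EAc: "sum E {..<?K} \<le> sum dual_price Ac / \<delta>"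
  proof -
    have "sum E {..<?K} \<le> (\<Sum>k<?K. \<Sum>j\<in>Ac. planned j k * dual_price j / \<delta>)"
      unfolding E_def Ac_def using final_energy_le by (intro sum_mono) auto
    also have "\<dots> = (\<Sum>j\<in>Ac. (\<Sum>k<?K. planned j k) * (dual_price j / \<delta>))"
      by (subst sum.swap) (simp add: sum_distrib_right sum_divide_distrib)
    also have "\<dots> = (\<Sum>j\<in>Ac. dual_price j / \<delta>)"
      using sum_planned_accepted by (intro sum.cong) (auto simp: Ac_def)
    finally show ?thesis by (simp add: sum_divide_distrib)
  qed
  have lC: "(\<Sum>k<?K. interval_length J k * C k) \<le>
      (\<alpha> - 1) / \<alpha> powr \<alpha> * (sum E {..<?K} + sum dual_price R / \<delta>)"
  proof -
    have "(\<Sum>k<?K. interval_length J k * C k) =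
        (\<alpha> - 1) / \<alpha> powr \<alpha> * (\<Sum>k<?K. E k + (\<Sum>j\<in>R. planned j k * dual_price j / \<delta>))"
      unfolding sum_distrib_left
    proof (rule sum.cong[OF refl])
      fix k assume "k \<in> {..<?K}"
      then show "interval_length J k * C k =
          (\<alpha> - 1) / \<alpha> powr \<alpha> * (E k + (\<Sum>j\<in>R. planned j k * dual_price j / \<delta>))"
        using interval_length_pos[of k] by (simp add: C_def B_def)
    qed
    also have "(\<Sum>k<?K. E k + (\<Sum>j\<in>R. planned j k * dual_price j / \<delta>)) =
        sum E {..<?K} + (\<Sum>j\<in>R. (\<Sum>k<?K. planned j k) * (dual_price j / \<delta>))"
      unfolding sum.distrib by (subst sum.swap) (simp add: sum_distrib_right sum_divide_distrib)
    also have "(\<Sum>j\<in>R. (\<Sum>k<?K. planned j k) * (dual_price j / \<delta>)) \<le> (\<Sum>j\<in>R. 1 * (dual_price j / \<delta>))"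
      using sum_planned_rejected dual_price_bounds \<delta>
      by (intro sum_mono mult_right_mono) (auto simp: R_def)
    finally show ?thesis using \<alpha> by (simp add: sum_divide_distrib mult_left_mono divide_right_mono)
  qed
  have Rv: "sum dual_price R = (\<Sum>j\<in>R. worth (J ! j))"
    using dual_price_rejected by (intro sum.cong) (auto simp: R_def)
  have R0: "0 \<le> sum dual_price R" using dual_price_bounds by (intro sum_nonneg) (auto simp: R_def)
  have E0: "0 \<le> E k" if k: "k < ?K" for k
  proof -
    have "0 \<le> real m * (sum (unit_load J k (\<lambda>i. final i k)) jobs / real m) powr \<alpha>" by simp
    also have "\<dots> \<le> chen_energy \<alpha> m jobs (unit_load J k (\<lambda>i. final i k))"
      by (rule chen_energy_ge_average[OF _ m base_load_nonneg[OF assignment_state[OF order_refl] k] \<alpha>]) simp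
    finally have "0 \<le> interval_length J k * chen_energy \<alpha> m jobs (unit_load J k (\<lambda>i. final i k))"
      using interval_length_pos[OF k] by simp
    also have "\<dots> = E k"
      unfolding E_def by (rule interval_energy_eq[symmetric, OF m _ workload_pos interval_length_pos[OF k]])
        (use assignment_state[of "length J"] k in \<open>auto simp: assignment_def\<close>)
    finally show ?thesis .
  qed
  have pd: "pd_cost \<alpha> m \<delta> J = sum E {..<?K} + sum dual_price R"
    unfolding pd_cost_def Rv unfolding E_def R_def ..
  \<comment> \<open>PD's energy counts once as cost and \<open>\<alpha> - 1\<close> times in the
    conjugate term; the prices of accepted jobs pay for this. For rejected jobs the factor \<open>1
    + (\<alpha> - 1) / \<delta> = 1 + \<alpha> powr \<alpha> - \<alpha> powr (\<alpha> - 1)\<close>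
    is at most \<open>\<alpha> powr \<alpha>\<close>.\<close>
  have "(\<alpha> - 1) * (sum dual_price R / \<delta>) = (\<alpha> powr \<alpha> - \<alpha> powr (\<alpha> - 1)) * sum dual_price R"
    using \<alpha>\<delta> \<delta> by (simp add: pw field_simps)
  moreover have "sum dual_price R \<le> \<alpha> powr (\<alpha> - 1) * sum dual_price R"
    using mult_right_mono[OF ge_one_powr_ge_zero[of \<alpha> "\<alpha> - 1"] R0] \<alpha> by simp
  moreover have "\<alpha> * sum E {..<?K} \<le> \<alpha> powr \<alpha> * sum dual_price Ac"
  proof -
    have "\<alpha> * sum E {..<?K} \<le> \<alpha> * (sum dual_price Ac / \<delta>)"
      using EAc \<alpha>0 by (intro mult_left_mono) auto
    also have "\<dots> = \<alpha> powr \<alpha> * sum dual_price Ac" using \<alpha>\<delta> \<delta> by (simp add: field_simps)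
    finally show ?thesis .
  qed
  moreover have "\<alpha> powr \<alpha> * (\<Sum>k<?K. interval_length J k * C k) \<le>
      (\<alpha> - 1) * (sum E {..<?K} + sum dual_price R / \<delta>)"
    using mult_left_mono[OF lC less_imp_le[OF pa]] pa by simp
  ultimately have real: "pd_cost \<alpha> m \<delta> J + \<alpha> powr \<alpha> * (\<Sum>k<?K. interval_length J k * C k) \<le>
      \<alpha> powr \<alpha> * sum dual_price jobs"
    unfolding pd split by (simp add: algebra_simps)
  define c where "c = (\<Sum>k<?K. interval_length J k * C k)"
  have c0: "0 \<le> c"
  proof -
    have "0 \<le> interval_length J k * C k" if "k < ?K" for k
      unfolding C_def B_def R_def
      using \<alpha> \<delta> interval_length_pos[OF that] E0[OF that] planned_nonneg dual_price_bounds that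
      by (intro mult_nonneg_nonneg divide_nonneg_nonneg add_nonneg_nonneg sum_nonneg) (auto simp: less_imp_le)
    then show ?thesis unfolding c_def by (intro sum_nonneg) auto
  qed
  have pd0: "0 \<le> pd_cost \<alpha> m \<delta> J" unfolding pd 
    by (rule add_nonneg_nonneg[OF sum_nonneg R0]) (use E0 in auto)
  \<comment> \<open>The conjugate term \<open>c\<close> is a finite real, so it cancels in
    \<open>ennreal\<close> even if the schedule has infinite cost.\<close>
  have "ennreal (pd_cost \<alpha> m \<delta> J) + ennreal (\<alpha> powr \<alpha> * c) = ennreal (pd_cost \<alpha> m \<delta> J + \<alpha> powr \<alpha> * c)"
    using pd0 c0 pa by (intro ennreal_plus[symmetric]) auto
  also have "\<dots> \<le> ennreal (\<alpha> powr \<alpha> * sum dual_price jobs)"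
    using real by (intro ennreal_leI) (simp add: c_def)
  also have "\<dots> = ennreal (\<alpha> powr \<alpha>) * ennreal (sum dual_price jobs)" by (rule ennreal_mult') simp
  also have "\<dots> \<le> ennreal (\<alpha> powr \<alpha>) * (schedule_cost \<alpha> m J S + ennreal c)"
    using dual by (intro mult_left_mono) (auto simp: c_def)
  also have "\<dots> = ennreal (\<alpha> powr \<alpha>) * schedule_cost \<alpha> m J S + ennreal (\<alpha> powr \<alpha> * c)"
    by (simp add: distrib_left ennreal_mult')
  finally show ?thesis by (simp add: ennreal_add_left_cancel_le add.commute[of _ "ennreal (\<alpha> powr \<alpha> * c)"])
qed

end

section \<open>Instances with many stages\<close>

lemma chen_speed_cong:
  assumes "\<And>j. j \<in> A \<Longrightarrow> a j = b j" "i \<in> A"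
  shows "chen_speed m A a i = chen_speed m A b i"
  using pool_level_cong[of A a b m] assms by (simp add: chen_speed_def)

lemma sum_div_blocks:
  fixes f :: "nat \<Rightarrow> real"
  shows "(\<Sum>j<n * m. f (j div m)) = real m * (\<Sum>i<n. f i)"
proof -
  have "(\<Sum>j<n * m. f (j div m)) = (\<Sum>i<n. \<Sum>j\<in>{i * m..<i * m + m}. f (j div m))"
    by (rule sum.nat_group[symmetric])
  also have "\<dots> = (\<Sum>i<n. \<Sum>j\<in>{i * m..<i * m + m}. f i)"
  proof (intro sum.cong refl)
    fix i j assume "j \<in> {i * m..<i * m + m}"
    then have "j div m = i" by (intro div_nat_eqI) (auto simp: mult.commute)
    then show "f (j div m) = f i" by simp
  qed
  finally show ?thesis by (simp add: sum_distrib_left)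
qed

text \<open>Stage \<open>i\<close> has \<open>m\<close> equal jobs of workload \<open>w i\<close>
  released at \<open>\<tau> i\<close> with common deadline \<open>\<tau> n\<close>; job
  \<open>j\<close> belongs to stage \<open>j div m\<close>. The geometric parameters enter only in
  \<open>geometric_instance_bound\<close>.\<close>

locale staged =
  fixes \<alpha> :: real and m :: nat and \<delta> :: real and n :: nat and \<tau> w :: "nat \<Rightarrow> real"
  assumes \<alpha>: "\<alpha> > 1" and m: "m \<ge> 1" and \<delta>: "\<delta> > 0" and n: "n \<ge> 1"
    and \<tau>0: "0 \<le> \<tau> 0" and \<tau>: "\<And>a b. a < b \<Longrightarrow> b \<le> n \<Longrightarrow> \<tau> a < \<tau> b"
    and w: "\<And>i. i < n \<Longrightarrow> 0 < w i"
begin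

definition rest :: "nat \<Rightarrow> real" where "rest i = \<tau> n - \<tau> i"
definition len :: "nat \<Rightarrow> real" where "len k = \<tau> (Suc k) - \<tau> k"

text \<open>Loads per unit of time when each job up to \<open>j\<close> is spread evenly until the
  deadline. No interval is mentioned, since earlier jobs are available wherever \<open>j\<close>
  is.\<close>

definition densities :: "nat \<Rightarrow> nat \<Rightarrow> real" where
  "densities j i = (if i \<le> j then w (i div m) / rest (i div m) else 0)"

text \<open>The marginal cost of job \<open>j\<close> under even spreading, which turns out to be
  its price.\<close>

definition target :: "nat \<Rightarrow> real" where
  "target j = \<delta> * (\<alpha> * w (j div m) * chen_speed m {..<n * m} (densities j) j powr (\<alpha> - 1))"

text \<open>The common value exceeds every price that PD ever has to reach, so PD accepts every job.\<close>

definition jobs_list :: "job list" where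
  "jobs_list = map (\<lambda>j. \<lparr>release = \<tau> (j div m), deadline = \<tau> n, workload = w (j div m),
     worth = 1 + (\<Sum>j<n * m. target j)\<rparr>) [0..<n * m]"

lemma stage_less: "j < n * m \<Longrightarrow> j div m < n"
  by (simp add: less_mult_imp_div_less)

lemma rest_pos: "i < n \<Longrightarrow> 0 < rest i"
  using \<tau>[of i n] by (simp add: rest_def)

lemma len_pos: "k < n \<Longrightarrow> 0 < len k"
  using \<tau>[of k "Suc k"] by (simp add: len_def)

lemma \<tau>_le: "a \<le> b \<Longrightarrow> b \<le> n \<Longrightarrow> \<tau> a \<le> \<tau> b"
  using \<tau>[of a b] by (cases "a = b") auto

lemma \<tau>_le_iff: "a \<le> n \<Longrightarrow> b \<le> n \<Longrightarrow> \<tau> a \<le> \<tau> b \<longleftrightarrow> a \<le> b"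
  using \<tau>_le[of a b] \<tau>[of b a] by (cases "a \<le> b") auto

lemma target_nonneg: "j < n * m \<Longrightarrow> 0 \<le> target j"
  using \<alpha> \<delta> w stage_less by (simp add: target_def less_imp_le)

lemma length_jobs_list: "length jobs_list = n * m"
  by (simp add: jobs_list_def)

lemma nth_jobs_list:
  assumes "j < n * m"
  shows "release (jobs_list ! j) = \<tau> (j div m)" "deadline (jobs_list ! j) = \<tau> n"
    "workload (jobs_list ! j) = w (j div m)"
    "worth (jobs_list ! j) = 1 + (\<Sum>j<n * m. target j)"
  using assms by (simp_all add: jobs_list_def)

lemma job_instance_jobs_list: "job_instance jobs_list"
  unfolding job_instance_def
proof
  have "0 \<le> (\<Sum>j<n * m. target j)" using target_nonneg by (intro sum_nonneg) auto
  then have "0 \<le> release (jobs_list ! j) \<and> release (jobs_list ! j) < deadline (jobs_list ! j) \<and>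
      0 < workload (jobs_list ! j) \<and> 0 < worth (jobs_list ! j)" if "j < n * m" for j
    using that stage_less[OF that] \<tau>0 \<tau>_le[of 0 "j div m"] \<tau>[of "j div m" n] w[of "j div m"]
    by (simp add: nth_jobs_list)
  then show "\<forall>q\<in>set jobs_list. 0 \<le> release q \<and> release q < deadline q \<and> 0 < workload q \<and> 0 < worth q"
    by (auto simp: in_set_conv_nth length_jobs_list)
  show "sorted (map release jobs_list)"
    unfolding sorted_iff_nth_mono
    using \<tau>_le stage_less by (auto simp: length_jobs_list nth_jobs_list div_le_mono less_imp_le)
qed

lemma time_points_jobs_list: "time_points jobs_list = map \<tau> [0..<Suc n]"
proof -
  have rel: "release ` set jobs_list = \<tau> ` {..<n}"
  proof -
    have "(\<lambda>j. j div m) ` {..<n * m} = {..<n}"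
    proof
      show "{..<n} \<subseteq> (\<lambda>j. j div m) ` {..<n * m}"
        using m by (auto simp: image_iff intro!: bexI[of _ "_ * m"])
    qed (use stage_less in auto)
    then have "\<tau> ` {..<n} = \<tau> ` ((\<lambda>j. j div m) ` {..<n * m})" by simp
    also have "\<dots> = release ` set jobs_list"
      by (simp add: jobs_list_def image_image atLeast_upt)
    finally show ?thesis by simp
  qed
  have dl: "deadline ` set jobs_list = {\<tau> n}"
    using n m by (auto simp: jobs_list_def image_image intro!: image_eqI[of _ _ 0])
  have set: "set (map \<tau> [0..<Suc n]) = release ` set jobs_list \<union> deadline ` set jobs_list"
    unfolding rel dl by (auto simp: less_Suc_eq)
  have sorted: "sorted_wrt (<) (map \<tau> [0..<Suc n])"
    by (auto simp: sorted_wrt_iff_nth_less \<tau> simp del: upt_Suc)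
  show ?thesis
    unfolding time_points_def set[symmetric]
    by (rule strict_sorted_equal[OF sorted strict_sorted_list_of_set]) (rule set_sorted_list_of_set, rule finite_set)
qed

lemma num_intervals_jobs_list: "num_intervals jobs_list = n"
  by (simp add: num_intervals_def time_points_jobs_list)

lemma nth_time_points: "k \<le> n \<Longrightarrow> time_points jobs_list ! k = \<tau> k"
  by (simp add: time_points_jobs_list nth_append del: upt_Suc)

lemma interval_length_jobs_list: "k < n \<Longrightarrow> interval_length jobs_list k = len k"
  by (simp add: interval_length_def nth_time_points len_def)

lemma available_jobs_list: "j < n * m \<Longrightarrow> k < n \<Longrightarrow> available jobs_list j k \<longleftrightarrow> j div m \<le> k"
  using stage_less[of j] \<tau>_le[of "Suc k" n]
  by (simp add: available_def nth_time_points nth_jobs_list \<tau>_le_iff less_imp_le)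

sublocale pd_run \<alpha> m \<delta> jobs_list
  by unfold_locales (rule \<alpha> m \<delta> job_instance_jobs_list)+

lemma sum_len: "i < n \<Longrightarrow> (\<Sum>k<n. if i \<le> k then len k / rest i else 0) = 1"
proof -
  assume i: "i < n"
  have "(\<Sum>k<n. if i \<le> k then len k / rest i else 0) = (\<Sum>k\<in>{k\<in>{..<n}. i \<le> k}. len k / rest i)"
    by (rule sum.inter_filter[symmetric]) simp
  also have "{k\<in>{..<n}. i \<le> k} = {i..<n}" by auto
  also have "(\<Sum>k\<in>{i..<n}. len k / rest i) = (\<tau> n - \<tau> i) / rest i"
    unfolding len_def sum_divide_distrib[symmetric] by (subst sum_Suc_diff') (use i in auto)
  also have "\<dots> = 1" using rest_pos[OF i] by (simp add: rest_def)
  finally show ?thesis .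
qed

text \<open>All intervals available to a job carry the same load densities, so PD's marginal costs agree
  exactly when the job is spread in proportion to the interval lengths.\<close>

lemma spread_step:
  assumes j: "j < n * m"
    and st: "\<And>i k. i < n * m \<Longrightarrow> k < n \<Longrightarrow>
      state j i k = (if i < j \<and> i div m \<le> k then len k / rest (i div m) else 0)"
  shows "accepts (state j) j" and
    "\<And>k. k < n \<Longrightarrow> pd_portions \<alpha> m \<delta> jobs_list (state j) j k =
      (if j div m \<le> k then len k / rest (j div m) else 0)"
proof -
  let ?i = "j div m"
  have jl: "j < length jobs_list" using j by (simp add: length_jobs_list)
  have X: "assignment (state j)" using jl by (intro assignment_state) simp
  have i: "?i < n" by (rule stage_less[OF j])
  have lev: "level (state j) j k (target j) = (if ?i \<le> k then len k / rest ?i else 0)" if k: "k < n" for k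
  proof (cases "?i \<le> k")
    case True
    have kK: "k < num_intervals jobs_list" using k by (simp add: num_intervals_jobs_list)
    have av: "available jobs_list j k" using available_jobs_list[OF j k] True by simp
    have z: "0 \<le> len k / rest ?i" using len_pos[OF k] rest_pos[OF i] by simp
    have "speed_at (state j) j k (len k / rest ?i) = chen_speed m jobs (densities j) j"
    proof (rule chen_speed_cong)
      fix i' assume "i' \<in> jobs"
      then have i': "i' < n * m" by (simp add: length_jobs_list)
      have "i' div m \<le> k" if "i' \<le> j" using div_le_mono[OF that, of m] True by simp
      then show "unit_load jobs_list k ((\<lambda>i. state j i k)(j := len k / rest ?i)) i' = densities j i'"
        using len_pos[OF k]
        by (auto simp: unit_load_def load_def densities_def interval_length_jobs_list[OF k]
            nth_jobs_list[OF i'] st[OF i' k])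
    qed (use jl in simp)
    then have "marginal (state j) j k (len k / rest ?i) = target j"
      unfolding marginal_eq[OF X jl kK z] target_def nth_jobs_list[OF j] length_jobs_list by simp
    then show ?thesis using pd_level_marginal[OF X jl kK av z] True by simp
  next
    case False
    then have "\<not> available jobs_list j k" using available_jobs_list[OF j k] by simp
    then show ?thesis using False by (simp add: pd_level_def)
  qed
  have "raised (state j) j (target j) = 1"
    unfolding pd_total_def num_intervals_jobs_list using lev sum_len[OF i] by simp
  moreover have "target j \<le> worth (jobs_list ! j)"
    unfolding nth_jobs_list(4)[OF j] using member_le_sum[of j "{..<n * m}" target] target_nonneg j by simp
  ultimately have "accepts (state j) j" "price (state j) j = target j"
    using price_unique[OF X jl target_nonneg[OF j]] by auto
  then show "accepts (state j) j" "\<And>k. k < n \<Longrightarrow> pd_portions \<alpha> m \<delta> jobs_list (state j) j k =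
      (if ?i \<le> k then len k / rest ?i else 0)"
    using lev by (simp_all add: pd_portions_def)
qed

lemma state_jobs_list:
  "j \<le> n * m \<Longrightarrow> i < n * m \<Longrightarrow> k < n \<Longrightarrow>
    state j i k = (if i < j \<and> i div m \<le> k then len k / rest (i div m) else 0)"
proof (induction j arbitrary: i k)
  case (Suc j)
  then show ?case using spread_step(2)[of j k] by (simp add: less_Suc_eq)
qed simp

text \<open>Every job is accepted, so the cost is energy only. In interval \<open>k\<close> the
  average load per processor and unit of time is the density sum of the stages up to
  \<open>k\<close>.\<close>

lemma pd_cost_ge:
  "real m * (\<Sum>k<n. len k * (\<Sum>i\<le>k. w i / rest i) powr \<alpha>) \<le> pd_cost \<alpha> m \<delta> jobs_list"
proof -
  let ?J = jobs_list
  have "{j. j < length ?J \<and> \<not> pd_accepts \<alpha> m \<delta> ?J (state j) j} = {}"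
    using spread_step(1) state_jobs_list by (auto simp: length_jobs_list)
  then have "pd_cost \<alpha> m \<delta> ?J = (\<Sum>k<n. interval_energy \<alpha> m ?J k (\<lambda>i. final i k))"
    unfolding pd_cost_def num_intervals_jobs_list by (simp only: sum.empty add_0_right)
  moreover have "real m * (len k * (\<Sum>i\<le>k. w i / rest i) powr \<alpha>) \<le>
      interval_energy \<alpha> m ?J k (\<lambda>i. final i k)" if k: "k < n" for k
  proof -
    have kK: "k < num_intervals ?J" using k by (simp add: num_intervals_jobs_list)
    let ?a = "unit_load ?J k (\<lambda>i. final i k)"
    have "?a j = (if j div m \<le> k then w (j div m) / rest (j div m) else 0)" if j: "j < n * m" for j
      using j k len_pos[OF k]
      by (simp add: unit_load_def load_def interval_length_jobs_list nth_jobs_list state_jobs_list length_jobs_list)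
    then have "sum ?a jobs = (\<Sum>j<n * m. if j div m \<le> k then w (j div m) / rest (j div m) else 0)"
      by (simp add: length_jobs_list)
    also have "\<dots> = real m * (\<Sum>i<n. if i \<le> k then w i / rest i else 0)"
      by (rule sum_div_blocks)
    also have "(\<Sum>i<n. if i \<le> k then w i / rest i else 0) = (\<Sum>i\<in>{i\<in>{..<n}. i \<le> k}. w i / rest i)"
      by (rule sum.inter_filter[symmetric]) simp
    also have "{i\<in>{..<n}. i \<le> k} = {..k}" using k by auto
    finally have "sum ?a jobs / real m = (\<Sum>i\<le>k. w i / rest i)" using m by simp
    then have "real m * (\<Sum>i\<le>k. w i / rest i) powr \<alpha> \<le> chen_energy \<alpha> m jobs ?a"
      using chen_energy_ge_average[OF _ m base_load_nonneg[OF assignment_state[OF order_refl] kK] \<alpha>] by simp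
    then have "len k * (real m * (\<Sum>i\<le>k. w i / rest i) powr \<alpha>) \<le> len k * chen_energy \<alpha> m jobs ?a"
      using len_pos[OF k] by (intro mult_left_mono) auto
    also have "\<dots> = interval_energy \<alpha> m ?J k (\<lambda>i. final i k)"
      using interval_energy_eq[OF m _ workload_pos interval_length_pos[OF kK], of "\<lambda>i. final i k" \<alpha>]
        assignment_state[of "length ?J"] kK
      by (simp add: assignment_def interval_length_jobs_list[OF k])
    finally show ?thesis by (simp add: mult_ac)
  qed
  ultimately show ?thesis unfolding sum_distrib_left by (auto intro!: sum_mono)
qed

section \<open>An offline schedule finishing every stage in its own slot\<close>

definition slot :: "nat \<Rightarrow> real set" where "slot k = {\<tau> k..<\<tau> (Suc k)}"

text \<open>In slot \<open>k\<close> the \<open>m\<close> jobs of stage \<open>k\<close> occupy one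
  processor each and finish at its end. The sum of indicators makes the speed visibly
  measurable.\<close>

definition stage_schedule :: schedule where
  "stage_schedule =
    \<lparr>speed = (\<lambda>c t. \<Sum>k<n. w k / len k * indicator (slot k) t),
     run = (\<lambda>c t. if \<exists>k<n. t \<in> slot k then Some ((THE k. k < n \<and> t \<in> slot k) * m + c) else None)\<rparr>"

lemma slot_unique:
  assumes "k < n" "k' < n" "t \<in> slot k" "t \<in> slot k'"
  shows "k = k'"
proof (rule ccontr)
  assume "k \<noteq> k'"
  then have "Suc k \<le> k' \<or> Suc k' \<le> k" by auto
  then show False using assms \<tau>_le[of "Suc k" k'] \<tau>_le[of "Suc k'" k] by (auto simp: slot_def)
qed

lemma run_in_slot: "k < n \<Longrightarrow> t \<in> slot k \<Longrightarrow> run stage_schedule c t = Some (k * m + c)"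
proof -
  assume k: "k < n" "t \<in> slot k"
  have "(THE k. k < n \<and> t \<in> slot k) = k"
  proof (rule the_equality)
    fix k' assume "k' < n \<and> t \<in> slot k'"
    then show "k' = k" using slot_unique[of k' k t] k by simp
  qed (use k in simp)
  moreover have "\<exists>k<n. t \<in> slot k" using k by blast
  ultimately show ?thesis by (simp add: stage_schedule_def)
qed

lemma speed_in_slot: "k < n \<Longrightarrow> t \<in> slot k \<Longrightarrow> speed stage_schedule c t = w k / len k"
proof -
  assume k: "k < n" "t \<in> slot k"
  have "(\<Sum>k<n. w k / len k * indicator (slot k) t) = (\<Sum>k'\<in>{k}. w k' / len k' * indicator (slot k') t)"
  proof (intro sum.mono_neutral_right ballI)
    fix k' assume "k' \<in> {..<n} - {k}"
    then have "t \<notin> slot k'" using k slot_unique[of k k' t] by auto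
    then show "w k' / len k' * indicator (slot k') t = 0" by simp
  qed (use k in auto)
  then show ?thesis using k by (simp add: stage_schedule_def)
qed

lemma outside_slots:
  assumes "\<not> (\<exists>k<n. t \<in> slot k)"
  shows "run stage_schedule c t = None" "speed stage_schedule c t = 0"
  using assms by (auto simp: stage_schedule_def intro!: sum.neutral)

lemma run_eq_iff:
  assumes c: "c < m"
  shows "run stage_schedule c t = Some j \<longleftrightarrow> j mod m = c \<and> j div m < n \<and> t \<in> slot (j div m)"
proof
  assume run: "run stage_schedule c t = Some j"
  then obtain k where k: "k < n" "t \<in> slot k" using outside_slots(1)[of t c] by fastforce
  then have "j = k * m + c" using run run_in_slot[OF k] by simp
  then show "j mod m = c \<and> j div m < n \<and> t \<in> slot (j div m)" using c k by simp
next
  assume "j mod m = c \<and> j div m < n \<and> t \<in> slot (j div m)"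
  then show "run stage_schedule c t = Some j"
    using run_in_slot[of "j div m" t c] div_mult_mod_eq[of j m] by simp
qed

lemma speed_stage_schedule_measurable: "speed stage_schedule c \<in> borel_measurable borel"
proof -
  have "(\<lambda>t. \<Sum>k<n. w k / len k * indicator (slot k) t) \<in> borel_measurable borel"
    by (intro borel_measurable_sum borel_measurable_times borel_measurable_const borel_measurable_indicator)
      (simp add: slot_def)
  then show ?thesis by (simp add: stage_schedule_def)
qed

lemma valid_stage_schedule: "valid_schedule m jobs_list stage_schedule"
  unfolding valid_schedule_def
proof (intro conjI allI impI)
  fix c j assume c: "c < m"
  have "{t. run stage_schedule c t = Some j} = (if j mod m = c \<and> j div m < n then slot (j div m) else {})"
    by (auto simp: run_eq_iff[OF c])
  then show "{t. run stage_schedule c t = Some j} \<in> sets borel" by (simp add: slot_def)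
next
  fix c t assume "c < m" "0 \<le> (t::real)"
  show "0 \<le> speed stage_schedule c t"
    unfolding stage_schedule_def using w len_pos
    by (simp, intro sum_nonneg mult_nonneg_nonneg divide_nonneg_pos) (auto simp: less_imp_le)
next
  fix c t j assume "c < m" "run stage_schedule c t = Some j"
  then have "j div m < n" using run_eq_iff[of c t j] by simp
  then show "j < length jobs_list"
    using m by (simp add: length_jobs_list div_less_iff_less_mult)
next
  fix c c' t j assume "c < m" "c' < m" "run stage_schedule c t = Some j \<and> run stage_schedule c' t = Some j"
  then show "c = c'" using run_eq_iff[of c t j] run_eq_iff[of c' t j] by simp
qed (rule speed_stage_schedule_measurable)

lemma stage_schedule_finishes:
  assumes j: "j < n * m"
  shows "finished m jobs_list stage_schedule j"
proof -
  let ?i = "j div m"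
  have i: "?i < n" by (rule stage_less[OF j])
  have jm: "j mod m < m" using m by simp
  have speed: "ennreal (job_speed m stage_schedule j t) = ennreal (w ?i / len ?i) * indicator (slot ?i) t" for t
  proof (cases "t \<in> slot ?i")
    case True
    have "{c. c < m \<and> run stage_schedule c t = Some j} = {c. c < m \<and> j mod m = c}"
      using run_eq_iff i True by (intro Collect_cong conj_cong refl) simp
    also have "\<dots> = {j mod m}" using jm by blast
    finally have set: "{c. c < m \<and> run stage_schedule c t = Some j} = {j mod m}" .
    have "job_speed m stage_schedule j t = w ?i / len ?i"
      unfolding job_speed_def set using speed_in_slot[OF i True] by simp
    then show ?thesis using True by simp
  next
    case False
    then have "{c. c < m \<and> run stage_schedule c t = Some j} = {c. c < m \<and> False}"
      using run_eq_iff by (intro Collect_cong conj_cong refl) simp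
    then have "{c. c < m \<and> run stage_schedule c t = Some j} = {}" by simp
    then have "job_speed m stage_schedule j t = 0" by (simp only: job_speed_def sum.empty)
    then show ?thesis using False by simp
  qed
  have sub: "slot ?i \<subseteq> {\<tau> ?i..\<tau> n}" using \<tau>_le[of "Suc ?i" n] i by (auto simp: slot_def)
  have "(\<integral>\<^sup>+t\<in>{\<tau> ?i..\<tau> n}. ennreal (job_speed m stage_schedule j t) \<partial>lborel) =
      (\<integral>\<^sup>+t. ennreal (w ?i / len ?i) * indicator (slot ?i) t \<partial>lborel)"
    unfolding speed using sub by (intro nn_integral_cong) (auto simp: indicator_def)
  also have "\<dots> = ennreal (w ?i / len ?i) * ennreal (len ?i)"
    using len_pos[OF i] by (subst nn_integral_cmult_indicator) (auto simp: slot_def len_def)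
  also have "\<dots> = ennreal (w ?i)"
    using len_pos[OF i] w[OF i] by (simp flip: ennreal_mult)
  finally show ?thesis unfolding finished_def nth_jobs_list[OF j] by simp
qed

lemma opt_cost_jobs_list_le:
  "opt_cost \<alpha> m jobs_list \<le> ennreal (real m * (\<Sum>k<n. len k * (w k / len k) powr \<alpha>))"
proof -
  have energy: "(\<integral>\<^sup>+t\<in>{0..}. ennreal (speed stage_schedule c t powr \<alpha>) \<partial>lborel) \<le>
      ennreal (\<Sum>k<n. len k * (w k / len k) powr \<alpha>)" for c
  proof -
    have "ennreal (speed stage_schedule c t powr \<alpha>) * indicator {0..} t \<le>
        (\<Sum>k<n. ennreal ((w k / len k) powr \<alpha>) * indicator (slot k) t)" for t
    proof (cases "\<exists>k<n. t \<in> slot k")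
      case True
      then obtain k where k: "k < n" "t \<in> slot k" by blast
      have "ennreal (speed stage_schedule c t powr \<alpha>) * indicator {0..} t \<le>
          ennreal ((w k / len k) powr \<alpha>) * indicator (slot k) t"
        using k speed_in_slot[OF k] by (simp add: indicator_def)
      also have "\<dots> \<le> (\<Sum>k<n. ennreal ((w k / len k) powr \<alpha>) * indicator (slot k) t)"
        using k by (intro member_le_sum) auto
      finally show ?thesis .
    next
      case False
      then show ?thesis using outside_slots(2)[OF False] by simp
    qed
    then have "(\<integral>\<^sup>+t\<in>{0..}. ennreal (speed stage_schedule c t powr \<alpha>) \<partial>lborel) \<le>
        (\<integral>\<^sup>+t. (\<Sum>k<n. ennreal ((w k / len k) powr \<alpha>) * indicator (slot k) t) \<partial>lborel)"
      by (intro nn_integral_mono)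
    also have "\<dots> = (\<Sum>k<n. \<integral>\<^sup>+t. ennreal ((w k / len k) powr \<alpha>) * indicator (slot k) t \<partial>lborel)"
      by (rule nn_integral_sum) (simp add: slot_def)
    also have "\<dots> = (\<Sum>k<n. ennreal (len k * (w k / len k) powr \<alpha>))"
    proof (rule sum.cong[OF refl])
      fix k assume "k \<in> {..<n}"
      then have "0 < len k" by (simp add: len_pos)
      then show "(\<integral>\<^sup>+t. ennreal ((w k / len k) powr \<alpha>) * indicator (slot k) t \<partial>lborel) =
          ennreal (len k * (w k / len k) powr \<alpha>)"
        by (subst nn_integral_cmult_indicator) (auto simp: slot_def len_def ennreal_mult' mult.commute)
    qed
    also have "\<dots> = ennreal (\<Sum>k<n. len k * (w k / len k) powr \<alpha>)"
      using len_pos by (intro sum_ennreal) (simp add: less_imp_le)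
    finally show ?thesis .
  qed
  have "opt_cost \<alpha> m jobs_list \<le> schedule_cost \<alpha> m jobs_list stage_schedule"
    unfolding opt_cost_def using valid_stage_schedule by (intro INF_lower) simp
  also have "rejected m jobs_list stage_schedule = {}"
    using stage_schedule_finishes by (auto simp: rejected_def length_jobs_list)
  then have "schedule_cost \<alpha> m jobs_list stage_schedule =
      (\<Sum>c<m. \<integral>\<^sup>+t\<in>{0..}. ennreal (speed stage_schedule c t powr \<alpha>) \<partial>lborel)"
    unfolding schedule_cost_def by (simp only: sum.empty ennreal_0 add_0_right)
  also have "\<dots> \<le> (\<Sum>c<m. ennreal (\<Sum>k<n. len k * (w k / len k) powr \<alpha>))"
    by (intro sum_mono energy)
  also have "\<dots> = ennreal (real m * (\<Sum>k<n. len k * (w k / len k) powr \<alpha>))"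
    by (simp add: ennreal_mult' ennreal_of_nat_eq_real_of_nat)
  finally show ?thesis .
qed

end

section \<open>From instances to the competitive ratio\<close>

lemma ennreal_divide_le_imp_le_mult:
  fixes a b c :: ennreal
  assumes "a / b \<le> c" "b < top" "c < top"
  shows "a \<le> c * b"
proof (cases "b = 0")
  \<comment> \<open>In \<open>ennreal\<close>, \<open>a / 0\<close> is \<open>top\<close> unless
    \<open>a = 0\<close>, so the finite bound forces \<open>a = 0\<close>.\<close>
  case True
  then show ?thesis using assms by (cases "a = 0") (auto simp: top_unique)
next
  case False
  have "a = a / b * b" using False assms(2) by (simp add: ennreal_divide_times)
  also have "\<dots> \<le> c * b" using assms(1) by (rule mult_right_mono) simp
  finally show ?thesis .
qed

lemma ennreal_divide_le_if_le_mult: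
  fixes a b c :: ennreal
  assumes "a \<le> c * b"
  shows "a / b \<le> c"
proof (cases "b = 0")
  case False
  then show ?thesis using assms by (intro divide_le_posI_ennreal) (auto simp: mult.commute zero_less_iff_neq_zero)
qed (use assms in simp)

lemma (in staged) energy_le_ratio_bound:
  assumes "competitive_ratio \<alpha> m \<delta> \<le> ennreal c" "0 \<le> c"
  shows "(\<Sum>k<n. len k * (\<Sum>i\<le>k. w i / rest i) powr \<alpha>) \<le> c * (\<Sum>k<n. len k * (w k / len k) powr \<alpha>)"
proof -
  define W where "W = (\<Sum>k<n. len k * (w k / len k) powr \<alpha>)"
  have W0: "0 \<le> W" unfolding W_def using len_pos by (intro sum_nonneg) (simp add: less_imp_le)
  have opt: "opt_cost \<alpha> m jobs_list \<le> ennreal (real m * W)"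
    unfolding W_def by (rule opt_cost_jobs_list_le)
  have "ennreal (pd_cost \<alpha> m \<delta> jobs_list) / opt_cost \<alpha> m jobs_list \<le> competitive_ratio \<alpha> m \<delta>"
    unfolding competitive_ratio_def using job_instance_jobs_list by (intro SUP_upper) simp
  also have "\<dots> \<le> ennreal c" by (rule assms(1))
  finally have "ennreal (pd_cost \<alpha> m \<delta> jobs_list) \<le> ennreal c * opt_cost \<alpha> m jobs_list"
    by (rule ennreal_divide_le_imp_le_mult) (use opt in \<open>auto intro: le_less_trans\<close>)
  also have "\<dots> \<le> ennreal c * ennreal (real m * W)" using opt by (rule mult_left_mono) simp
  also have "\<dots> = ennreal (c * (real m * W))" using assms(2) by (simp add: ennreal_mult')
  finally have "pd_cost \<alpha> m \<delta> jobs_list \<le> c * (real m * W)"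
    using assms(2) W0 by (subst (asm) ennreal_le_iff) auto
  then have "real m * (\<Sum>k<n. len k * (\<Sum>i\<le>k. w i / rest i) powr \<alpha>) \<le> real m * (c * W)"
    using pd_cost_ge by (simp add: mult_ac)
  then show ?thesis using m unfolding W_def[symmetric] by simp
qed

text \<open>Each of the first \<open>N\<close> stages costs \<open>1 - q\<close> per processor
  offline, and PD almost \<open>(1 - q) * B\<close>. The relative losses decay geometrically, so the
  correction \<open>\<alpha> / (1 - p)\<close> does not grow with \<open>N\<close>.\<close>

lemma geometric_instance_bound:
  fixes p c :: real
  assumes \<alpha>: "\<alpha> > 1" and m: "m \<ge> 1" and \<delta>: "\<delta> > 0" and p: "0 < p" "p < 1"
    and c: "competitive_ratio \<alpha> m \<delta> \<le> ennreal c" "0 \<le> c"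
  defines "q \<equiv> p powr \<alpha>"
  defines "B \<equiv> ((1 - q) / (1 - p)) powr \<alpha>"
  shows "(1 - q) * B * (real N - \<alpha> / (1 - p)) \<le> c * (real N * (1 - q) + 1)"
proof -
  \<comment> \<open>The last stage keeps the whole remaining interval up to 1, so its length is
    \<open>q ^ N\<close> instead of \<open>q ^ N * (1 - q)\<close>.\<close>
  define \<tau> where "\<tau> i = (if i \<le> N then 1 - q ^ i else 1)" for i
  define w where "w i = (1 - q) * q ^ i / p ^ i" for i
  have q: "0 < q" "q < 1" using p \<alpha> powr_less_mono2[of \<alpha> p 1] by (auto simp: q_def)
  have pq: "(p ^ k) powr \<alpha> = q ^ k" for k
    by (induction k) (use p in \<open>auto simp: powr_mult q_def\<close>)
  interpret staged \<alpha> m \<delta> "Suc N" \<tau> w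
  proof
    show "\<tau> a < \<tau> b" if "a < b" "b \<le> Suc N" for a b
      using that q power_strict_decreasing[of a b q] by (auto simp: \<tau>_def)
    show "0 < w i" for i using q p by (simp add: w_def)
  qed (use \<alpha> m \<delta> in \<open>auto simp: \<tau>_def\<close>)
  have len: "len k = q ^ k * (1 - q)" if "k < N" for k
    using that by (simp add: len_def \<tau>_def algebra_simps)
  have lenN: "len N = q ^ N" by (simp add: len_def \<tau>_def)
  have rest: "rest i = q ^ i" if "i \<le> N" for i using that by (simp add: rest_def \<tau>_def)
  have dens: "(\<Sum>i\<le>k. w i / rest i) = (1 - q) / (1 - p) * ((1 - p ^ Suc k) / p ^ k)" if "k \<le> N" for k
    using that
  proof (induction k)
    case 0
    then show ?case using q p by (simp add: w_def rest)
  next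
    case (Suc k)
    have "w (Suc k) / rest (Suc k) = (1 - q) / (1 - p) * ((1 - p) / p ^ Suc k)"
      using q p Suc.prems by (simp add: w_def rest)
    moreover have "(1 - p ^ Suc k) / p ^ k + (1 - p) / p ^ Suc k = (1 - p ^ Suc (Suc k)) / p ^ Suc k"
      using p by (simp add: field_simps)
    moreover have "(\<Sum>i\<le>k. w i / rest i) = (1 - q) / (1 - p) * ((1 - p ^ Suc k) / p ^ k)"
      using Suc by simp
    ultimately show ?case by (simp only: sum.atMost_Suc distrib_left[symmetric])
  qed
  have online: "(1 - q) * B * (1 - \<alpha> * p ^ Suc k) \<le> len k * (\<Sum>i\<le>k. w i / rest i) powr \<alpha>" if k: "k < N" for k
  proof -
    have p1: "p ^ Suc k \<le> 1" using p by (intro power_le_one) auto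
    have "((1 - q) / (1 - p) * ((1 - p ^ Suc k) / p ^ k)) powr \<alpha> = B * ((1 - p ^ Suc k) powr \<alpha> / q ^ k)"
      unfolding B_def using p q p1 by (subst powr_mult) (auto simp: powr_divide pq simp del: power_Suc)
    then have "len k * (\<Sum>i\<le>k. w i / rest i) powr \<alpha> = (1 - q) * B * (1 - p ^ Suc k) powr \<alpha>"
      using q k by (simp add: len dens)
    \<comment> \<open>Bernoulli's inequality, obtained as the tangent at speed 1.\<close>
    moreover have "1 - \<alpha> * p ^ Suc k \<le> (1 - p ^ Suc k) powr \<alpha>"
      using Young_powr[OF \<alpha>, of 1 "1 - p ^ Suc k"] p1 by (simp add: algebra_simps)
    moreover have "0 \<le> (1 - q) * B" using q by (simp add: B_def)
    ultimately show ?thesis by (simp only: mult_left_mono)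
  qed
  have geo: "(\<Sum>k<N. p ^ Suc k) \<le> 1 / (1 - p)"
  proof -
    have "(\<Sum>k<N. p ^ Suc k) \<le> (\<Sum>k<N. p ^ k)"
      using p by (intro sum_mono power_decreasing) auto
    also have "\<dots> = (1 - p ^ N) / (1 - p)" using p by (simp add: sum_gp_strict)
    also have "\<dots> \<le> 1 / (1 - p)" using p by (intro divide_right_mono) auto
    finally show ?thesis .
  qed
  have "real N - \<alpha> / (1 - p) \<le> (\<Sum>k<N. 1 - \<alpha> * p ^ Suc k)"
    using mult_left_mono[OF geo, of \<alpha>] \<alpha> by (simp add: sum_subtractf flip: sum_distrib_left)
  then have "(1 - q) * B * (real N - \<alpha> / (1 - p)) \<le> (1 - q) * B * (\<Sum>k<N. 1 - \<alpha> * p ^ Suc k)"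
    using q by (intro mult_left_mono) (auto simp: B_def)
  also have "\<dots> = (\<Sum>k<N. (1 - q) * B * (1 - \<alpha> * p ^ Suc k))" by (rule sum_distrib_left)
  also have "\<dots> \<le> (\<Sum>k<N. len k * (\<Sum>i\<le>k. w i / rest i) powr \<alpha>)"
    using online by (intro sum_mono) auto
  also have "\<dots> \<le> (\<Sum>k<Suc N. len k * (\<Sum>i\<le>k. w i / rest i) powr \<alpha>)"
    using len_pos[of N] by simp
  also have "\<dots> \<le> c * (\<Sum>k<Suc N. len k * (w k / len k) powr \<alpha>)"
    by (rule energy_le_ratio_bound[OF c])
  also have "(\<Sum>k<Suc N. len k * (w k / len k) powr \<alpha>) \<le> real N * (1 - q) + 1"
  proof -
    have "len k * (w k / len k) powr \<alpha> = 1 - q" if k: "k < N" for k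
    proof -
      have "w k / len k = 1 / p ^ k" using q k by (simp add: w_def len)
      then show ?thesis using q k p by (simp add: powr_divide pq len)
    qed
    moreover have "len N * (w N / len N) powr \<alpha> \<le> 1"
    proof -
      have "w N / len N = (1 - q) / p ^ N" using q by (simp add: w_def lenN)
      then have "len N * (w N / len N) powr \<alpha> = (1 - q) powr \<alpha>"
        using q p by (simp add: powr_divide pq lenN)
      also have "\<dots> \<le> 1" using q \<alpha> by (intro powr_le1) auto
      finally show ?thesis .
    qed
    ultimately show ?thesis by simp
  qed
  finally show ?thesis using c(2) by (simp add: mult_left_mono)
qed

text \<open>For fixed \<open>p\<close> the number of stages grows first; then \<open>p\<close> tends
  to 1, where the quotient converges to the derivative of \<open>x powr \<alpha>\<close> at
  1.\<close>

lemma competitive_ratio_ge: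
  assumes \<alpha>: "\<alpha> > 1" and m: "m \<ge> 1" and \<delta>: "\<delta> > 0"
  shows "ennreal (\<alpha> powr \<alpha>) \<le> competitive_ratio \<alpha> m \<delta>"
proof (cases "competitive_ratio \<alpha> m \<delta>")
  case (real c)
  let ?B = "\<lambda>p. (1 - p powr \<alpha>) / (1 - p)"
  have bound: "?B p powr \<alpha> \<le> c" if p: "0 < p" "p < 1" for p
  proof (rule ccontr)
    define q where "q = p powr \<alpha>"
    define b where "b = ((1 - q) / (1 - p)) powr \<alpha>"
    assume "\<not> ?B p powr \<alpha> \<le> c"
    then have bc: "c < b" by (simp add: b_def q_def)
    have q: "q < 1" using p \<alpha> powr_less_mono2[of \<alpha> p 1] by (simp add: q_def)
    then have pos: "0 < (1 - q) * (b - c)" using bc by simp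
    \<comment> \<open>If \<open>b\<close> exceeded \<open>c\<close>, each stage would gain
      \<open>(1 - q) * (b - c) > 0\<close>, which outgrows the terms constant in
      \<open>N\<close>.\<close>
    obtain N :: nat where N: "c + (1 - q) * b * (\<alpha> / (1 - p)) < real N * ((1 - q) * (b - c))"
      using reals_Archimedean3[OF pos] by blast
    have "(1 - q) * b * (real N - \<alpha> / (1 - p)) \<le> c * (real N * (1 - q) + 1)"
      unfolding b_def q_def by (rule geometric_instance_bound[OF \<alpha> m \<delta> p]) (use real in auto)
    then show False using N by (simp add: algebra_simps)
  qed
  have "((\<lambda>x. x powr \<alpha>) has_real_derivative \<alpha> * 1 powr (\<alpha> - 1)) (at 1)"
    by (rule has_real_derivative_powr) simp
  then have "((\<lambda>p. (p powr \<alpha> - 1) / (p - 1)) \<longlongrightarrow> \<alpha>) (at 1)"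
    by (simp add: has_field_derivative_iff)
  moreover have "(p powr \<alpha> - 1) / (p - 1) = ?B p" for p :: real
    using minus_divide_divide[of "p powr \<alpha> - 1" "p - 1"] by simp
  ultimately have "(?B \<longlongrightarrow> \<alpha>) (at 1)" by simp
  then have "(?B \<longlongrightarrow> \<alpha>) (at_left 1)" by (rule filterlim_mono) (auto intro: at_le)
  then have "((\<lambda>p. ?B p powr \<alpha>) \<longlongrightarrow> \<alpha> powr \<alpha>) (at_left 1)"
    using \<alpha> by (intro tendsto_powr tendsto_const) auto
  moreover have "eventually (\<lambda>p. ?B p powr \<alpha> \<le> c) (at_left 1)"
    unfolding eventually_at_left[OF zero_less_one] using bound by (intro bexI[of _ 0] exI[of _ 0]) auto
  ultimately have "\<alpha> powr \<alpha> \<le> c" by (rule tendsto_upperbound) simp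
  then show ?thesis using real by (simp add: ennreal_leI)
qed simp

text \<open>Dividing by the positive finite \<open>\<alpha> powr \<alpha>\<close> lets the bound for
  single schedules pass to the infimum.\<close>

lemma pd_cost_le_opt_cost:
  assumes \<alpha>: "\<alpha> > 1" and m: "m \<ge> 1" and \<delta>_eq: "\<delta> = 1 / \<alpha> powr (\<alpha> - 1)" and J: "job_instance J"
  shows "ennreal (pd_cost \<alpha> m \<delta> J) \<le> ennreal (\<alpha> powr \<alpha>) * opt_cost \<alpha> m J"
proof -
  interpret pd_run \<alpha> m \<delta> J using assms by unfold_locales auto
  have pos: "0 < ennreal (\<alpha> powr \<alpha>)" using \<alpha> by simp
  have "ennreal (pd_cost \<alpha> m \<delta> J) / ennreal (\<alpha> powr \<alpha>) \<le> opt_cost \<alpha> m J"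
    unfolding opt_cost_def
    using pd_cost_le[OF \<delta>_eq] by (intro INF_greatest divide_le_posI_ennreal[OF pos]) simp
  then show ?thesis
    using ennreal_divide_le_imp_le_mult[of "ennreal (pd_cost \<alpha> m \<delta> J)" "ennreal (\<alpha> powr \<alpha>)" "opt_cost \<alpha> m J"]
    by (cases "opt_cost \<alpha> m J = top") (use pos in \<open>auto simp: mult.commute less_top ennreal_mult_top\<close>)
qed

lemma opt_cost_Nil: "opt_cost \<alpha> m [] = 0"
proof -
  let ?S = "\<lparr>speed = (\<lambda>i t. 0), run = (\<lambda>i t. None)\<rparr>"
  have "opt_cost \<alpha> m [] \<le> schedule_cost \<alpha> m [] ?S"
    unfolding opt_cost_def by (intro INF_lower) (simp add: valid_schedule_def)
  also have "\<dots> = 0" by (simp add: schedule_cost_def rejected_def)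
  finally show ?thesis by simp
qed

theorem theorem3:
  fixes \<alpha> \<delta> :: real and m :: nat
  assumes "\<alpha> > 1" and "m \<ge> 1" and "\<delta> = 1 / \<alpha> powr (\<alpha> - 1)"
  shows "(\<forall>J. job_instance J \<longrightarrow>
            ennreal (pd_cost \<alpha> m \<delta> J) \<le> ennreal (\<alpha> powr \<alpha>) * opt_cost \<alpha> m J) \<and>
         (\<exists>J. job_instance J \<and>
            ennreal (pd_cost \<alpha> m \<delta> J) = ennreal (\<alpha> powr \<alpha>) * opt_cost \<alpha> m J) \<and>
         competitive_ratio \<alpha> m \<delta> = ennreal (\<alpha> powr \<alpha>)"
proof (intro conjI)
  note upper = pd_cost_le_opt_cost[OF assms]
  show "\<forall>J. job_instance J \<longrightarrow>
            ennreal (pd_cost \<alpha> m \<delta> J) \<le> ennreal (\<alpha> powr \<alpha>) * opt_cost \<alpha> m J"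
    using upper by blast
  \<comment> \<open>Exact equality is witnessed by the empty job set, where both costs are 0; that
    nonempty job sets come arbitrarily close to the factor is contained in the last
    conjunct.\<close>
  have Nil: "job_instance []" by (simp add: job_instance_def)
  have "ennreal (pd_cost \<alpha> m \<delta> []) = ennreal (\<alpha> powr \<alpha>) * opt_cost \<alpha> m []"
    using upper[OF Nil] by (simp add: opt_cost_Nil)
  then show "\<exists>J. job_instance J \<and>
            ennreal (pd_cost \<alpha> m \<delta> J) = ennreal (\<alpha> powr \<alpha>) * opt_cost \<alpha> m J"
    using Nil by blast
  show "competitive_ratio \<alpha> m \<delta> = ennreal (\<alpha> powr \<alpha>)"
  proof (rule antisym)
    show "competitive_ratio \<alpha> m \<delta> \<le> ennreal (\<alpha> powr \<alpha>)"
      unfolding competitive_ratio_def using upper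
      by (intro SUP_least ennreal_divide_le_if_le_mult) simp
    show "ennreal (\<alpha> powr \<alpha>) \<le> competitive_ratio \<alpha> m \<delta>"
      by (rule competitive_ratio_ge) (use assms in auto)
  qed
qed

end
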